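(* Let $s\ge2$ be an integer. For a word $w\in\{0,1,\dots,s-1\}^*$ define $$\|w\|=\sum_{j=0}^{s-1}(s-1-2j)\,|w|_j,\qquad |w|_j=\#\{i\in\{1,\dots,|w|\}:w_i=j\}.$$ Let $\xi$ be the pseudocenter of a connected component $V$ of $[0,\frac{s}{s+1}]\setminus\mathcal{E}$, with shortest even $s$-adic expansion $\xi=.w$. Then the matching index $\Delta_\xi$ of $V$ is $$\Delta_\xi=\frac{s+1}{2}\,\|w\|,$$ which is always a multiple of $s+1$.
   Context: For fixed integer $s\ge2$ and $\gamma\in\mathbb{R}$, $Q_\gamma:\mathbb{R}\to\mathbb{R}$ is defined by $Q_\gamma(x)=x+1$ if $x\le\gamma$ and $Q_\gamma(x)=1+s(1-x)$ if $x>\gamma$. Write $Q_\gamma^k(\gamma^{\pm}):=\lim_{x\to\gamma^{\pm}}Q_\gamma^k(x)$ and let $(Q_\gamma^k)'(\gamma^\pm)$ be the one-sided derivatives. $Q_\gamma$ satisfies the matching condition with matching exponents $\kappa^\pm$ (positive integers) if $Q_\gamma^{\kappa^-}(\gamma^-)=Q_\gamma^{\kappa^+}(\gamma^+)$ and $(Q_\gamma^{\kappa^-})'(\gamma^-)=(Q_\gamma^{\kappa^+})'(\gamma^+)$. The prematching set is $PM_\gamma:=\{Q_\gamma^j(\gamma^-):1\le j\le\kappa^--1\}\cup\{Q_\gamma^j(\gamma^+):1\le j\le\kappa^+-1\}$. The matching set is the (open) set of $\gamma$ such that $Q_\gamma$ satisfies the matching condition and $\gamma\notin PM_\gamma$;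 its components are the matching intervals and the bifurcation set $\mathcal{E}$ is its complement in $\mathbb{R}$. The exponents $\kappa^\pm$ are the same for all $\gamma$ in a matching interval, and $\Delta:=\kappa^+-\kappa^-$ is its matching index. An $s$-adic rational is a number $p/s^m$ with $p\in\mathbb{Z}$, $m\ge0$; its denominator is the smallest such power $s^m$. Every component of $[0,\frac{s}{s+1}]\setminus\mathcal{E}$ contains a unique $s$-adic rational of lowest denominator, called its pseudocenter. For a word $u=u_1\dots u_n$ with digits in $\{0,\dots,s-1\}$, $|u|=n$ and $.u=\sum_{i=1}^n u_is^{-i}$; an even expansion is a finite expansion of even length. *)

theory Defs
  imports "HOL-Analysis.Analysis"
begin

definition Q :: "nat \<Rightarrow> real \<Rightarrow> real \<Rightarrow> real" where
  "Q s \<gamma> x = (if x \<le> \<gamma> then x + 1 else 1 + real s * (1 - x))"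

text \<open>The filter \<open>F\<close> is meant to be \<open>at_left \<gamma>\<close> or \<open>at_right \<gamma>\<close>. The iterates may jump at \<open>\<gamma>\<close>, so the
  one-sided derivative uses the one-sided limit in place of the value at \<open>\<gamma>\<close>. Both limits always
  exist, as each iterate is piecewise affine with finitely many pieces.\<close>

definition side_val :: "nat \<Rightarrow> real \<Rightarrow> nat \<Rightarrow> real filter \<Rightarrow> real" where
  "side_val s \<gamma> k F = Lim F (\<lambda>x. (Q s \<gamma> ^^ k) x)"

definition side_deriv :: "nat \<Rightarrow> real \<Rightarrow> nat \<Rightarrow> real filter \<Rightarrow> real" where
  "side_deriv s \<gamma> k F = Lim F (\<lambda>x. ((Q s \<gamma> ^^ k) x - side_val s \<gamma> k F) / (x - \<gamma>))"

definition matching_condition :: "nat \<Rightarrow> real \<Rightarrow> nat \<Rightarrow> nat \<Rightarrow> bool" where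
  "matching_condition s \<gamma> km kp \<longleftrightarrow> km \<ge> 1 \<and> kp \<ge> 1 \<and>
     side_val s \<gamma> km (at_left \<gamma>) = side_val s \<gamma> kp (at_right \<gamma>) \<and>
     side_deriv s \<gamma> km (at_left \<gamma>) = side_deriv s \<gamma> kp (at_right \<gamma>)"

text \<open>If a pair satisfies the matching condition, then usually so do later pairs, such as
  \<open>(km + 1, kp + 1)\<close>; the matching exponents are those of the first matching. (All pairs
  satisfying the condition are comparable componentwise, so there is a least one.)\<close>

definition matching_exponents :: "nat \<Rightarrow> real \<Rightarrow> nat \<Rightarrow> nat \<Rightarrow> bool" where
  "matching_exponents s \<gamma> km kp \<longleftrightarrow> matching_condition s \<gamma> km kp \<and>
     (\<forall>km' kp'. matching_condition s \<gamma> km' kp' \<longrightarrow> km \<le> km' \<and> kp \<le> kp')"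

definition prematching_set :: "nat \<Rightarrow> real \<Rightarrow> nat \<Rightarrow> nat \<Rightarrow> real set" where
  "prematching_set s \<gamma> km kp =
     {side_val s \<gamma> j (at_left \<gamma>) | j. 1 \<le> j \<and> j \<le> km - 1} \<union>
     {side_val s \<gamma> j (at_right \<gamma>) | j. 1 \<le> j \<and> j \<le> kp - 1}"

definition matching_set :: "nat \<Rightarrow> real set" where
  "matching_set s =
     {\<gamma>. \<exists>km kp. matching_exponents s \<gamma> km kp \<and> \<gamma> \<notin> prematching_set s \<gamma> km kp}"

definition bifurcation_set :: "nat \<Rightarrow> real set" where
  "bifurcation_set s = - matching_set s"

definition has_matching_index :: "nat \<Rightarrow> real set \<Rightarrow> int \<Rightarrow> bool" where
  "has_matching_index s V d \<longleftrightarrow>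
     (\<exists>km kp. (\<forall>\<gamma>\<in>V. matching_exponents s \<gamma> km kp) \<and> d = int kp - int km)"

definition sadic :: "nat \<Rightarrow> real \<Rightarrow> bool" where
  "sadic s x \<longleftrightarrow> (\<exists>(p::int) (m::nat). x = real_of_int p / real s ^ m)"

definition sadic_denom :: "nat \<Rightarrow> real \<Rightarrow> nat" where
  "sadic_denom s x = s ^ (LEAST m. \<exists>p::int. x = real_of_int p / real s ^ m)"

definition is_pseudocenter :: "nat \<Rightarrow> real set \<Rightarrow> real \<Rightarrow> bool" where
  "is_pseudocenter s V \<xi> \<longleftrightarrow> \<xi> \<in> V \<and> sadic s \<xi> \<and>
     (\<forall>y\<in>V. sadic s y \<longrightarrow> sadic_denom s \<xi> \<le> sadic_denom s y)"

definition word_val :: "nat \<Rightarrow> nat list \<Rightarrow> real" where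
  "word_val s u = (\<Sum>i<length u. real (u ! i) / real s ^ (i + 1))"

definition even_expansion :: "nat \<Rightarrow> nat list \<Rightarrow> real \<Rightarrow> bool" where
  "even_expansion s u x \<longleftrightarrow> set u \<subseteq> {..<s} \<and> even (length u) \<and> word_val s u = x"

definition shortest_even_expansion :: "nat \<Rightarrow> nat list \<Rightarrow> real \<Rightarrow> bool" where
  "shortest_even_expansion s w x \<longleftrightarrow> even_expansion s w x \<and>
     (\<forall>u. even_expansion s u x \<longrightarrow> length w \<le> length u)"

definition word_norm :: "nat \<Rightarrow> nat list \<Rightarrow> int" where
  "word_norm s w = (\<Sum>j<s. (int s - 1 - 2 * int j) * int (count_list w j))"

end

theory Submission
  imports Defs
begin

text \<open>
  Close to \<open>\<gamma>\<close>, on either side, each iterate of \<open>Q\<close> is affine, so a one-sided orbit of \<open>\<gamma>\<close> is a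
  sequence of germs (position and slope). A germ below \<open>\<gamma>\<close> is translated by 1, a germ above \<open>\<gamma>\<close> is
  expanded, which multiplies its slope by \<open>- s\<close>. Hence the left and the right germ can meet only after
  equally many expansions, \<open>n\<close> say, and then their positions differ by an integer, both being
  congruent to \<open>(- s) ^ n * \<gamma>\<close> modulo 1.

  This gives a ladder of configurations. After \<open>n\<close> expansions a low germ sits at the residue
  \<open>r\<^sub>n = frac ((- s) ^ n * \<gamma>)\<close>, as long as the residues exceed \<open>\<gamma>\<close>, and a high germ sits \<open>k\<^sub>n > 0\<close> above
  it, where \<open>k\<^sub>n\<^sub>+\<^sub>1 = 1 + s - s * r\<^sub>n - r\<^sub>n\<^sub>+\<^sub>1\<close>. Expanding both reverses their order, and the new low germ
  needs \<open>s * k\<^sub>n - k\<^sub>n\<^sub>+\<^sub>1\<close> translations to arrive at the next residue (\<open>rung_Suc\<close>). At the first index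
  \<open>m \<ge> 1\<close> with \<open>r\<^sub>m < \<gamma>\<close> the gap shrinks by one and the germs meet then or one expansion later. Summing the
  translations with alternating signs, the right time minus the left time telescopes to \<open>- (s + 1)\<close> times
  \<open>(\<Sum>n\<le>m. (-1) ^ n * k\<^sub>n) - (-1) ^ m\<close> (\<open>meet_of_first_return\<close>).

  If the orbits avoid \<open>\<gamma>\<close>, a small change of \<open>\<gamma>\<close> does not change the branches taken, so the matching
  exponents are constant on a connected set of matching parameters
  (\<open>matching_exponents_constant_on_connected\<close>). It therefore suffices to treat the pseudocenter \<open>\<xi>\<close>, with
  denominator \<open>s ^ e\<close>. Its residue at \<open>e\<close> is 0, so \<open>m \<le> e\<close>. If \<open>m < e\<close>, then moving \<open>\<xi>\<close> to the
  point where the residue at \<open>m\<close> vanishes stays within the matching set, and hence within the component,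
  and ends at an \<open>s\<close>-adic rational of smaller denominator (\<open>segment_in_matching_set\<close>). So \<open>m = e\<close>
  (\<open>pseudocenter_first_return\<close>).

  Finally, for \<open>0 < n < e\<close> the gap \<open>k\<^sub>n\<close> is \<open>s - w\<^sub>n\<close> or \<open>1 + w\<^sub>n\<close>, according to the parity of \<open>n\<close>. Adding
  up, the alternating sum is the sum of the digits minus \<open>s - 1\<close> for each pair of digits, which is
  minus one half of the norm of the word (\<open>gap_sum\<close>).
\<close>

section \<open>Germs of the iterates at the discontinuity\<close>

text \<open>Arbitrarily close to \<open>\<gamma>\<close> on one side every iterate of \<open>Q\<close> is affine, so it is determined by
  its one-sided value \<open>v\<close> and slope \<open>b\<close>. The side is encoded by a sign \<open>\<tau>\<close>: points \<open>x\<close> on it satisfy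
  \<open>0 < \<tau> * (x - \<gamma>)\<close>. If \<open>v = \<gamma>\<close>, the sign of \<open>\<tau> * b\<close> tells on which side of \<open>\<gamma>\<close> the iterate lies, and
  hence which branch of \<open>Q\<close> comes next.\<close>

definition germ_step :: "nat \<Rightarrow> real \<Rightarrow> real \<Rightarrow> real \<times> real \<Rightarrow> real \<times> real" where
  "germ_step s \<gamma> \<tau> = (\<lambda>(v, b). if v < \<gamma> \<or> v = \<gamma> \<and> \<tau> * b < 0 then (v + 1, b)
     else (1 + real s * (1 - v), - real s * b))"

definition pos :: "nat \<Rightarrow> real \<Rightarrow> real \<Rightarrow> nat \<Rightarrow> real" where
  "pos s \<gamma> \<tau> k = fst ((germ_step s \<gamma> \<tau> ^^ k) (\<gamma>, 1))"

definition slope :: "nat \<Rightarrow> real \<Rightarrow> real \<Rightarrow> nat \<Rightarrow> real" where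
  "slope s \<gamma> \<tau> k = snd ((germ_step s \<gamma> \<tau> ^^ k) (\<gamma>, 1))"

definition on_left :: "nat \<Rightarrow> real \<Rightarrow> real \<Rightarrow> nat \<Rightarrow> bool" where
  "on_left s \<gamma> \<tau> k \<longleftrightarrow>
     pos s \<gamma> \<tau> k < \<gamma> \<or> pos s \<gamma> \<tau> k = \<gamma> \<and> \<tau> * slope s \<gamma> \<tau> k < 0"

lemma pos_0 [simp]: "pos s \<gamma> \<tau> 0 = \<gamma>" and slope_0 [simp]: "slope s \<gamma> \<tau> 0 = 1"
  by (simp_all add: pos_def slope_def)

lemma pos_Suc: "pos s \<gamma> \<tau> (Suc k) =
    (if on_left s \<gamma> \<tau> k then pos s \<gamma> \<tau> k + 1 else 1 + real s * (1 - pos s \<gamma> \<tau> k))"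
  and slope_Suc: "slope s \<gamma> \<tau> (Suc k) =
    (if on_left s \<gamma> \<tau> k then slope s \<gamma> \<tau> k else - real s * slope s \<gamma> \<tau> k)"
  by (simp_all add: pos_def slope_def germ_step_def on_left_def case_prod_beta)

lemma slope_nonzero: "s \<ge> 1 \<Longrightarrow> slope s \<gamma> \<tau> k \<noteq> 0"
  by (induction k) (auto simp: slope_Suc)

text \<open>The only delicate case of the induction is an iterate whose limit is \<open>\<gamma>\<close>; there the nonzero slope
  decides the branch on the whole side.\<close>

lemma iterate_eq_germ:
  assumes s: "s \<ge> 1" and side: "eventually (\<lambda>x. 0 < \<tau> * (x - \<gamma>)) F" and F: "F \<le> nhds \<gamma>"
  shows "eventually (\<lambda>x. (Q s \<gamma> ^^ k) x = pos s \<gamma> \<tau> k + slope s \<gamma> \<tau> k * (x - \<gamma>)) F"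
proof (induction k)
  case 0
  then show ?case by simp
next
  case (Suc k)
  define v b where "v = pos s \<gamma> \<tau> k" and "b = slope s \<gamma> \<tau> k"
  have b0: "b \<noteq> 0" using slope_nonzero s by (simp add: b_def)
  have "((\<lambda>x. v + b * (x - \<gamma>)) \<longlongrightarrow> v + b * (\<gamma> - \<gamma>)) (nhds \<gamma>)"
    by (intro tendsto_intros filterlim_ident)
  then have lim: "((\<lambda>x. v + b * (x - \<gamma>)) \<longlongrightarrow> v) F"
    using F by (simp add: tendsto_mono)
  have br: "eventually (\<lambda>x. v + b * (x - \<gamma>) \<le> \<gamma> \<longleftrightarrow> on_left s \<gamma> \<tau> k) F"
  proof -
    consider "v < \<gamma>" | "v > \<gamma>" | "v = \<gamma>" by linarith
    then show ?thesis
    proof cases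
      case 1
      with order_tendstoD(2)[OF lim 1] show ?thesis
        by (auto simp: on_left_def v_def b_def elim: eventually_mono)
    next
      case 2
      with order_tendstoD(1)[OF lim 2] show ?thesis
        by (auto simp: on_left_def v_def b_def elim: eventually_mono)
    next
      case 3
      show ?thesis using side
      proof (rule eventually_mono)
        fix x assume x: "0 < \<tau> * (x - \<gamma>)"
        have "b * (x - \<gamma>) \<le> 0 \<longleftrightarrow> \<tau> * b < 0"
          using x b0 by (auto simp: zero_less_mult_iff mult_le_0_iff mult_less_0_iff)
        then show "(v + b * (x - \<gamma>) \<le> \<gamma>) = on_left s \<gamma> \<tau> k"
          using 3 by (simp add: on_left_def v_def b_def)
      qed
    qed
  qed
  show ?case using Suc br
  proof eventually_elim
    case (elim x)
    have "(Q s \<gamma> ^^ Suc k) x = Q s \<gamma> (v + b * (x - \<gamma>))"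
      using elim(1) by (simp add: v_def b_def)
    also have "\<dots> = pos s \<gamma> \<tau> (Suc k) + slope s \<gamma> \<tau> (Suc k) * (x - \<gamma>)"
      using elim(2)
      by (cases "on_left s \<gamma> \<tau> k")
        (simp_all add: Q_def pos_Suc slope_Suc v_def b_def algebra_simps)
    finally show ?case .
  qed
qed

lemma side_val_deriv_eq_germ:
  assumes s: "s \<ge> 1" and side: "eventually (\<lambda>x. 0 < \<tau> * (x - \<gamma>)) F"
    and F: "F \<le> nhds \<gamma>" "F \<noteq> bot"
  shows "side_val s \<gamma> k F = pos s \<gamma> \<tau> k" "side_deriv s \<gamma> k F = slope s \<gamma> \<tau> k"
proof -
  note ev = iterate_eq_germ[OF s side F(1), of k]
  have "((\<lambda>x. pos s \<gamma> \<tau> k + slope s \<gamma> \<tau> k * (x - \<gamma>)) \<longlongrightarrow>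
      pos s \<gamma> \<tau> k + slope s \<gamma> \<tau> k * (\<gamma> - \<gamma>)) (nhds \<gamma>)"
    by (intro tendsto_intros filterlim_ident)
  then have "((\<lambda>x. pos s \<gamma> \<tau> k + slope s \<gamma> \<tau> k * (x - \<gamma>)) \<longlongrightarrow> pos s \<gamma> \<tau> k) F"
    using F(1) by (simp add: tendsto_mono)
  moreover have "eventually (\<lambda>x. pos s \<gamma> \<tau> k + slope s \<gamma> \<tau> k * (x - \<gamma>) = (Q s \<gamma> ^^ k) x) F"
    using ev by eventually_elim simp
  ultimately have "((\<lambda>x. (Q s \<gamma> ^^ k) x) \<longlongrightarrow> pos s \<gamma> \<tau> k) F"
    by (rule Lim_transform_eventually)
  then show val: "side_val s \<gamma> k F = pos s \<gamma> \<tau> k"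
    unfolding side_val_def by (rule tendsto_Lim[OF F(2)])
  have "eventually (\<lambda>x. slope s \<gamma> \<tau> k = ((Q s \<gamma> ^^ k) x - side_val s \<gamma> k F) / (x - \<gamma>)) F"
    using ev side by eventually_elim (auto simp: val)
  then have "((\<lambda>x. ((Q s \<gamma> ^^ k) x - side_val s \<gamma> k F) / (x - \<gamma>)) \<longlongrightarrow> slope s \<gamma> \<tau> k) F"
    by (rule Lim_transform_eventually[OF tendsto_const])
  then show "side_deriv s \<gamma> k F = slope s \<gamma> \<tau> k"
    unfolding side_deriv_def by (rule tendsto_Lim[OF F(2)])
qed

lemma left_germ:
  assumes "s \<ge> 1"
  shows "side_val s \<gamma> k (at_left \<gamma>) = pos s \<gamma> (-1) k"
    "side_deriv s \<gamma> k (at_left \<gamma>) = slope s \<gamma> (-1) k"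
proof -
  have "eventually (\<lambda>x. 0 < (-1) * (x - \<gamma>)) (at_left \<gamma>)"
    by (simp add: eventually_at_filter)
  moreover have "at_left \<gamma> \<le> nhds \<gamma>" by (simp add: at_within_def)
  moreover have "at_left \<gamma> \<noteq> bot" by (rule trivial_limit_at_left_real)
  ultimately show "side_val s \<gamma> k (at_left \<gamma>) = pos s \<gamma> (-1) k"
    "side_deriv s \<gamma> k (at_left \<gamma>) = slope s \<gamma> (-1) k"
    by (rule side_val_deriv_eq_germ[OF assms])+
qed

lemma right_germ:
  assumes "s \<ge> 1"
  shows "side_val s \<gamma> k (at_right \<gamma>) = pos s \<gamma> 1 k"
    "side_deriv s \<gamma> k (at_right \<gamma>) = slope s \<gamma> 1 k"
proof -
  have "eventually (\<lambda>x. 0 < 1 * (x - \<gamma>)) (at_right \<gamma>)"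
    by (simp add: eventually_at_filter)
  moreover have "at_right \<gamma> \<le> nhds \<gamma>" by (simp add: at_within_def)
  moreover have "at_right \<gamma> \<noteq> bot" by (rule trivial_limit_at_right_real)
  ultimately show "side_val s \<gamma> k (at_right \<gamma>) = pos s \<gamma> 1 k"
    "side_deriv s \<gamma> k (at_right \<gamma>) = slope s \<gamma> 1 k"
    by (rule side_val_deriv_eq_germ[OF assms])+
qed

section \<open>Meetings of the two one-sided orbits\<close>

definition meet :: "nat \<Rightarrow> real \<Rightarrow> nat \<Rightarrow> nat \<Rightarrow> bool" where
  "meet s \<gamma> a b \<longleftrightarrow> pos s \<gamma> (-1) a = pos s \<gamma> 1 b \<and> slope s \<gamma> (-1) a = slope s \<gamma> 1 b"

lemma matching_condition_iff_meet:
  "s \<ge> 1 \<Longrightarrow> matching_condition s \<gamma> a b \<longleftrightarrow> a \<ge> 1 \<and> b \<ge> 1 \<and> meet s \<gamma> a b"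
  by (simp add: matching_condition_def meet_def left_germ right_germ)

definition avoids :: "nat \<Rightarrow> real \<Rightarrow> real \<Rightarrow> nat \<Rightarrow> bool" where
  "avoids s \<gamma> \<tau> k \<longleftrightarrow> (\<forall>j. 1 \<le> j \<and> j < k \<longrightarrow> pos s \<gamma> \<tau> j \<noteq> \<gamma>)"

lemma prematching_set_iff_avoids:
  assumes "s \<ge> 1"
  shows "\<gamma> \<notin> prematching_set s \<gamma> a b \<longleftrightarrow> avoids s \<gamma> (-1) a \<and> avoids s \<gamma> 1 b"
proof -
  have lt: "1 \<le> j \<and> j \<le> k - 1 \<longleftrightarrow> 1 \<le> j \<and> j < k" for j k :: nat by auto
  show ?thesis
    unfolding prematching_set_def avoids_def left_germ[OF assms] right_germ[OF assms] lt
    by auto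
qed

text \<open>Translations keep the slope and raise the position by 1, expansions enlarge the slope in absolute
  value. So the slope records how many expansions have happened, and two times with the same slope are
  separated by translations only.\<close>

lemma slope_mono_pos:
  assumes "s \<ge> 2" "i \<le> k"
  shows "\<bar>slope s \<gamma> \<tau> i\<bar> < \<bar>slope s \<gamma> \<tau> k\<bar> \<or>
    slope s \<gamma> \<tau> k = slope s \<gamma> \<tau> i \<and> pos s \<gamma> \<tau> k = pos s \<gamma> \<tau> i + real (k - i)"
  using assms(2)
proof (induction k rule: dec_induct)
  case base
  then show ?case by simp
next
  case (step k)
  have nz: "\<bar>slope s \<gamma> \<tau> k\<bar> > 0" using slope_nonzero assms by simp
  have "\<bar>slope s \<gamma> \<tau> k\<bar> * 1 < \<bar>slope s \<gamma> \<tau> k\<bar> * real s"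
    using nz assms(1) by (intro mult_strict_left_mono) auto
  then have lt: "\<bar>slope s \<gamma> \<tau> k\<bar> < \<bar>real s * slope s \<gamma> \<tau> k\<bar>"
    by (simp add: abs_mult mult.commute)
  show ?case
    using step lt by (cases "on_left s \<gamma> \<tau> k") (auto simp: slope_Suc pos_Suc Suc_diff_le)
qed

text \<open>If one orbit had advanced between the two meetings and the other had not (or had gone back), the
  equal slopes would leave only translations on both orbits, and these move the positions apart.
  This monotonicity is what makes a least meeting pair exist.\<close>

lemma meet_comparable:
  assumes s: "s \<ge> 2" and m: "meet s \<gamma> a b" "meet s \<gamma> a' b'"
  shows "a < a' \<longleftrightarrow> b < b'"
proof -
  have A: "k < l"
    if eq: "pos s \<gamma> \<tau> i = pos s \<gamma> \<sigma> k" "slope s \<gamma> \<tau> i = slope s \<gamma> \<sigma> k"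
       "pos s \<gamma> \<tau> j = pos s \<gamma> \<sigma> l" "slope s \<gamma> \<tau> j = slope s \<gamma> \<sigma> l" and "i < j"
     for i j k l \<tau> \<sigma>
  proof (rule ccontr)
    assume "\<not> k < l"
    then have "l \<le> k" by simp
    from slope_mono_pos[OF s this, of \<gamma> \<sigma>] slope_mono_pos[OF s less_imp_le[OF \<open>i < j\<close>], of \<gamma> \<tau>]
    have "pos s \<gamma> \<tau> j = pos s \<gamma> \<tau> i + real (j - i)" "pos s \<gamma> \<sigma> k = pos s \<gamma> \<sigma> l + real (k - l)"
      using eq by linarith+
    then show False using eq \<open>i < j\<close> by simp
  qed
  show ?thesis
    using A[of "-1" a 1 b a' b'] A[of 1 b "-1" a b' a'] m by (auto simp: meet_def)
qed

lemma meet_Suc: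
  assumes "meet s \<gamma> a b" "pos s \<gamma> (-1) a \<noteq> \<gamma>"
  shows "meet s \<gamma> (Suc a) (Suc b)"
  using assms by (auto simp: meet_def pos_Suc slope_Suc on_left_def)

lemma avoids_mono: "avoids s \<gamma> \<tau> k \<Longrightarrow> i \<le> k \<Longrightarrow> avoids s \<gamma> \<tau> i"
  by (auto simp: avoids_def)

text \<open>Two germs that have met at a point other than \<open>\<gamma>\<close> take the same branch, so they stay together and
  both times grow at the same rate. Any meeting before a visit to \<open>\<gamma>\<close> therefore has the same time
  difference as the first one, which spares the explicit computation of the first meeting.\<close>

lemma matching_exponents_from_meet:
  assumes s: "s \<ge> 2" and m: "meet s \<gamma> a b" "a \<ge> 1" "b \<ge> 1"
    and av: "avoids s \<gamma> (-1) a" "avoids s \<gamma> 1 b"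
  obtains km kp where "matching_exponents s \<gamma> km kp" "\<gamma> \<notin> prematching_set s \<gamma> km kp"
    "int kp - int km = int b - int a"
proof -
  have s1: "s \<ge> 1" using s by simp
  define P where "P x \<longleftrightarrow> (\<exists>y. matching_condition s \<gamma> x y)" for x
  define km where "km = (LEAST x. P x)"
  have "P a" using m s1 by (auto simp: P_def matching_condition_iff_meet)
  then have "P km" and km_le: "\<And>x. P x \<Longrightarrow> km \<le> x"
    unfolding km_def by (auto intro: LeastI Least_le)
  then obtain kp where kp: "matching_condition s \<gamma> km kp" by (auto simp: P_def)
  then have mk: "meet s \<gamma> km kp" "km \<ge> 1" "kp \<ge> 1"
    using s1 by (auto simp: matching_condition_iff_meet)
  have least: "km \<le> x \<and> kp \<le> y" if "matching_condition s \<gamma> x y" for x y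
  proof -
    have "P x" using that by (auto simp: P_def)
    then have "km \<le> x" by (rule km_le)
    moreover have "meet s \<gamma> x y" using that s1 by (simp add: matching_condition_iff_meet)
    ultimately show ?thesis using meet_comparable[OF s _ mk(1), of x y] by auto
  qed
  have "km \<le> a" "kp \<le> b" using least[of a b] m s1 by (auto simp: matching_condition_iff_meet)
  have "meet s \<gamma> (km + i) (kp + i)" if "km + i \<le> a" for i
    using that
  proof (induction i)
    case 0
    then show ?case using mk by simp
  next
    case (Suc i)
    moreover have "pos s \<gamma> (-1) (km + i) \<noteq> \<gamma>"
      using av(1) Suc.prems mk(2) by (simp add: avoids_def)
    ultimately show ?case using meet_Suc by simp
  qed
  \<comment> \<open>Following the first meeting up to time \<open>a\<close> gives a second partner for \<open>a\<close>; comparability identifies it with \<open>b\<close>.\<close>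
  from this[of "a - km"] have "meet s \<gamma> a (kp + (a - km))" using \<open>km \<le> a\<close> by simp
  from meet_comparable[OF s this m(1)] meet_comparable[OF s m(1) this]
  have "b = kp + (a - km)" by simp
  then have "int kp - int km = int b - int a" using \<open>km \<le> a\<close> by simp
  moreover have "matching_exponents s \<gamma> km kp"
    unfolding matching_exponents_def using kp least by blast
  moreover have "\<gamma> \<notin> prematching_set s \<gamma> km kp"
    unfolding prematching_set_iff_avoids[OF s1]
    using avoids_mono[OF av(1) \<open>km \<le> a\<close>] avoids_mono[OF av(2) \<open>kp \<le> b\<close>] by simp
  ultimately show ?thesis using that by blast
qed

section \<open>Local constancy of the matching exponents\<close>

text \<open>While the orbit avoids \<open>\<gamma>\<close>, a nearby parameter produces the same sequence of branches. The initial
  point moves with the parameter, and the derivative of the position in the parameter is then the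
  slope of the germ: under \<open>v \<mapsto> v + 1\<close> and \<open>v \<mapsto> 1 + s * (1 - v)\<close> both quantities are multiplied by
  \<open>1\<close> and \<open>- s\<close>.\<close>

lemma germ_perturbation:
  assumes "avoids s \<gamma> \<tau> K"
  shows "eventually (\<lambda>\<gamma>'. \<forall>k\<le>K. pos s \<gamma>' \<tau> k = pos s \<gamma> \<tau> k + slope s \<gamma> \<tau> k * (\<gamma>' - \<gamma>) \<and>
    slope s \<gamma>' \<tau> k = slope s \<gamma> \<tau> k) (nhds \<gamma>)"
  using assms
proof (induction K)
  case 0
  then show ?case by simp
next
  case (Suc K)
  define v b where "v = pos s \<gamma> \<tau> K" and "b = slope s \<gamma> \<tau> K"
  have "avoids s \<gamma> \<tau> K" using Suc.prems by (rule avoids_mono) simp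
  note IH = Suc.IH[OF this]
  have "((\<lambda>\<gamma>'. v + b * (\<gamma>' - \<gamma>) - \<gamma>') \<longlongrightarrow> v + b * (\<gamma> - \<gamma>) - \<gamma>) (nhds \<gamma>)"
    by (intro tendsto_intros filterlim_ident)
  then have lim: "((\<lambda>\<gamma>'. v + b * (\<gamma>' - \<gamma>) - \<gamma>') \<longlongrightarrow> v - \<gamma>) (nhds \<gamma>)"
    by simp
  have br: "eventually (\<lambda>\<gamma>'. on_left s \<gamma>' \<tau> K = on_left s \<gamma> \<tau> K) (nhds \<gamma>)"
  proof (cases "K = 0")
    case True
    then show ?thesis by (simp add: on_left_def)
  next
    case False
    then have "v \<noteq> \<gamma>" using Suc.prems by (simp add: avoids_def v_def)
    then consider "v - \<gamma> < 0" | "v - \<gamma> > 0" by linarith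
    then show ?thesis
    proof cases
      case 1
      from IH order_tendstoD(2)[OF lim 1] show ?thesis
      proof eventually_elim
        case (elim \<gamma>')
        have "pos s \<gamma>' \<tau> K = v + b * (\<gamma>' - \<gamma>)" using elim(1) by (auto simp: v_def b_def)
        then show ?case using elim(2) 1 by (simp add: on_left_def v_def)
      qed
    next
      case 2
      from IH order_tendstoD(1)[OF lim 2] show ?thesis
      proof eventually_elim
        case (elim \<gamma>')
        have "pos s \<gamma>' \<tau> K = v + b * (\<gamma>' - \<gamma>)" using elim(1) by (auto simp: v_def b_def)
        then show ?case using elim(2) 2 by (simp add: on_left_def v_def)
      qed
    qed
  qed
  from IH br show ?case
  proof eventually_elim
    case (elim \<gamma>')
    have "pos s \<gamma>' \<tau> (Suc K) = pos s \<gamma> \<tau> (Suc K) + slope s \<gamma> \<tau> (Suc K) * (\<gamma>' - \<gamma>) \<and>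
        slope s \<gamma>' \<tau> (Suc K) = slope s \<gamma> \<tau> (Suc K)"
    proof (cases "on_left s \<gamma> \<tau> K")
      case True
      then show ?thesis using elim by (simp add: pos_Suc slope_Suc)
    next
      case False
      moreover have "pos s \<gamma>' \<tau> K = pos s \<gamma> \<tau> K + slope s \<gamma> \<tau> K * (\<gamma>' - \<gamma>)"
        using elim by simp
      ultimately show ?thesis using elim by (simp add: pos_Suc slope_Suc) (simp add: algebra_simps)
    qed
    then show ?case using elim(1) by (auto simp: le_Suc_eq)
  qed
qed

text \<open>Germs with equal slopes move in parallel as the parameter varies, so exactly the same pairs of times
  up to \<open>(a, b)\<close> are meeting pairs for nearby parameters.\<close>

lemma matching_exponents_locally_constant:
  assumes s: "s \<ge> 2" and me: "matching_exponents s \<gamma> a b" and pm: "\<gamma> \<notin> prematching_set s \<gamma> a b"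
  shows "eventually (\<lambda>\<gamma>'. matching_exponents s \<gamma>' a b) (nhds \<gamma>)"
proof -
  have s1: "s \<ge> 1" using s by simp
  have ab: "a \<ge> 1" "b \<ge> 1" "meet s \<gamma> a b"
    and least: "\<And>x y. x \<ge> 1 \<Longrightarrow> y \<ge> 1 \<Longrightarrow> meet s \<gamma> x y \<Longrightarrow> a \<le> x \<and> b \<le> y"
    using me unfolding matching_exponents_def matching_condition_iff_meet[OF s1] by blast+
  have av: "avoids s \<gamma> (-1) a" "avoids s \<gamma> 1 b"
    using pm s1 by (auto simp: prematching_set_iff_avoids)
  from germ_perturbation[OF av(1)] germ_perturbation[OF av(2)] show ?thesis
  proof eventually_elim
    case (elim \<gamma>')
    have same: "meet s \<gamma>' x y \<longleftrightarrow> meet s \<gamma> x y" if "x \<le> a" "y \<le> b" for x y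
    proof -
      have "pos s \<gamma>' (-1) x = pos s \<gamma> (-1) x + slope s \<gamma> (-1) x * (\<gamma>' - \<gamma>)"
        "slope s \<gamma>' (-1) x = slope s \<gamma> (-1) x"
        "pos s \<gamma>' 1 y = pos s \<gamma> 1 y + slope s \<gamma> 1 y * (\<gamma>' - \<gamma>)"
        "slope s \<gamma>' 1 y = slope s \<gamma> 1 y"
        using elim that by blast+
      then show ?thesis unfolding meet_def by auto
    qed
    have "a \<le> x \<and> b \<le> y" if xy: "x \<ge> 1" "y \<ge> 1" "meet s \<gamma>' x y" for x y
    proof -
      have "meet s \<gamma>' a b" using same ab by simp
      from meet_comparable[OF s xy(3) this] have cmp: "x < a \<longleftrightarrow> y < b" .
      show ?thesis
      proof (cases "x < a")
        case True
        then show ?thesis using least[OF xy(1,2)] xy(3) same[of x y] cmp by simp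
      qed (use cmp in auto)
    qed
    then show ?case
      unfolding matching_exponents_def matching_condition_iff_meet[OF s1]
      using ab same[of a b] by blast
  qed
qed

lemma matching_exponents_constant_on_connected:
  assumes s: "s \<ge> 2" and V: "connected V" "V \<subseteq> matching_set s"
    and \<xi>: "\<xi> \<in> V" "matching_exponents s \<xi> a b" and \<gamma>: "\<gamma> \<in> V"
  shows "matching_exponents s \<gamma> a b"
proof -
  have unique: "c = c' \<and> d = d'"
    if "matching_exponents s x c d" "matching_exponents s x c' d'" for x c d c' d'
    using that unfolding matching_exponents_def by (blast intro: order_antisym)
  have "\<forall>x\<in>V. eventually (\<lambda>y. matching_exponents s x a b = matching_exponents s y a b) (at x within V)"
  proof
    fix x assume "x \<in> V"
    then obtain c d where cd: "matching_exponents s x c d" "x \<notin> prematching_set s x c d"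
      using V by (auto simp: matching_set_def)
    have "eventually (\<lambda>y. matching_exponents s x a b = matching_exponents s y a b) (nhds x)"
      using matching_exponents_locally_constant[OF s cd]
    proof eventually_elim
      case (elim y)
      show ?case using unique[OF cd(1), of a b] unique[OF elim, of a b] cd(1) elim by auto
    qed
    then show "eventually (\<lambda>y. matching_exponents s x a b = matching_exponents s y a b) (at x within V)"
      unfolding eventually_at_filter by (rule eventually_mono) simp
  qed
  from connected_local_const[OF V(1) \<xi>(1) \<gamma> this] show ?thesis using \<xi>(2) by simp
qed

section \<open>The parameter 0\<close>

text \<open>At \<open>\<gamma> = 0\<close> the left orbit is stuck at the fixed point 1, whereas the right orbit cycles through
  \<open>1 + s\<close> and the integers from \<open>1 - s * s\<close> to \<open>0\<close>. This excludes 0 as a pseudocenter.\<close>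

lemma zero_notin_matching_set:
  assumes s: "s \<ge> 2"
  shows "0 \<notin> matching_set s"
proof -
  have left: "pos s 0 (-1) (Suc k) = 1" for k
    by (induction k) (auto simp: pos_Suc on_left_def)
  have right: "(\<exists>i::int. pos s 0 1 k = of_int i \<and> i \<le> 0 \<and> slope s 0 1 k > 0) \<or>
      (pos s 0 1 k = 1 + real s \<and> slope s 0 1 k < 0)" for k
  proof (induction k)
    case 0
    then show ?case by (auto intro: exI[of _ 0])
  next
    case (Suc k)
    then consider i :: int where "pos s 0 1 k = of_int i" "i < 0" "slope s 0 1 k > 0"
      | "pos s 0 1 k = 0" "slope s 0 1 k > 0" | "pos s 0 1 k = 1 + real s" "slope s 0 1 k < 0"
      by (fastforce simp: order_le_less)
    then show ?case
    proof cases
      case (1 i)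
      then have "pos s 0 1 (Suc k) = of_int (i + 1) \<and> i + 1 \<le> 0 \<and> slope s 0 1 (Suc k) > 0"
        by (simp add: pos_Suc slope_Suc on_left_def)
      then show ?thesis by blast
    next
      case 2
      then have "pos s 0 1 (Suc k) = 1 + real s \<and> slope s 0 1 (Suc k) < 0"
        using s by (simp add: pos_Suc slope_Suc on_left_def)
      then show ?thesis by blast
    next
      case 3
      have "(1::int) \<le> int s * int s" using s mult_mono[of 1 "int s" 1 "int s"] by simp
      with 3 have "pos s 0 1 (Suc k) = of_int (1 - int s * int s) \<and> 1 - int s * int s \<le> 0 \<and>
          slope s 0 1 (Suc k) > 0"
        using s by (simp add: pos_Suc slope_Suc on_left_def algebra_simps mult_less_0_iff)
      then show ?thesis by blast
    qed
  qed
  have "\<not> matching_exponents s 0 a b" for a b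
  proof
    assume "matching_exponents s 0 a b"
    then have "a \<ge> 1" "pos s 0 (-1) a = pos s 0 1 b"
      using s by (auto simp: matching_exponents_def matching_condition_iff_meet meet_def)
    with left[of "a - 1"] have "pos s 0 1 b = 1" by simp
    with right[of b] s show False by auto
  qed
  then show ?thesis by (simp add: matching_set_def)
qed

section \<open>The ladder of expansions\<close>

lemma translation_run:
  assumes "pos s \<gamma> \<tau> c = y - real t" "y < \<gamma> + 1" "avoids s \<gamma> \<tau> c" "c \<ge> 1"
  shows "pos s \<gamma> \<tau> (c + t) = y \<and> slope s \<gamma> \<tau> (c + t) = slope s \<gamma> \<tau> c \<and> avoids s \<gamma> \<tau> (c + t)"
  using assms
proof (induction t arbitrary: c)
  case 0
  then show ?case by simp
next
  case (Suc t)
  have "pos s \<gamma> \<tau> c < \<gamma>" using Suc.prems by simp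
  then have "pos s \<gamma> \<tau> (Suc c) = y - real t" "slope s \<gamma> \<tau> (Suc c) = slope s \<gamma> \<tau> c"
    "avoids s \<gamma> \<tau> (Suc c)"
    using Suc.prems by (auto simp: pos_Suc slope_Suc on_left_def avoids_def less_Suc_eq)
  then show ?case using Suc.IH[of "Suc c"] Suc.prems by simp
qed

text \<open>A snapshot after \<open>n\<close> expansions of both orbits: the low germ is at \<open>z\<close> at time \<open>a\<close>, the high germ at
  \<open>z + k\<close> at time \<open>b\<close>, and \<open>d\<close> is the difference of times. An expansion reverses the order, so the low
  orbit is the right one for even \<open>n\<close> and the left one for odd \<open>n\<close>. Only the low germ of the initial
  snapshot is at time 0; it is the one germ that may be at \<open>\<gamma>\<close> itself.\<close>

definition rung :: "nat \<Rightarrow> real \<Rightarrow> nat \<Rightarrow> real \<Rightarrow> int \<Rightarrow> int \<Rightarrow> bool" where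
  "rung s \<gamma> n z k d \<longleftrightarrow> (\<exists>a b.
     pos s \<gamma> ((-1) ^ n) a = z \<and> slope s \<gamma> ((-1) ^ n) a = (- real s) ^ n \<and> avoids s \<gamma> ((-1) ^ n) a \<and>
     pos s \<gamma> (- ((-1) ^ n)) b = z + of_int k \<and> slope s \<gamma> (- ((-1) ^ n)) b = (- real s) ^ n \<and>
     avoids s \<gamma> (- ((-1) ^ n)) b \<and>
     (a = 0 \<longleftrightarrow> n = 0) \<and> b \<ge> 1 \<and> int a - int b = d)"

lemma rung_0: "rung s \<gamma> 0 \<gamma> 1 (-1)"
  unfolding rung_def
  by (rule exI[of _ 0], rule exI[of _ 1]) (simp add: pos_Suc slope_Suc on_left_def avoids_def)

text \<open>The low germ expands once and becomes the high germ, at \<open>z' + k'\<close>. The high germ expands to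
  \<open>z' + k' - s * k\<close> and then climbs to \<open>z'\<close> by \<open>s * k - k'\<close> translations, all of which start strictly
  below \<open>\<gamma>\<close> because \<open>z' < \<gamma> + 1\<close>.\<close>

lemma rung_Suc:
  assumes r: "rung s \<gamma> n z k d"
    and z: "\<gamma> < z \<or> n = 0 \<and> z = \<gamma>" and k: "k \<ge> 1"
    and z': "1 + real s * (1 - z) = z' + of_int k'" "z' < \<gamma> + 1" and k': "k' \<le> int s * k"
  shows "rung s \<gamma> (Suc n) z' k' (int s * k - k' - d)"
proof -
  define \<tau> :: real where "\<tau> = (-1) ^ n"
  from r obtain a b where
    a: "pos s \<gamma> \<tau> a = z" "slope s \<gamma> \<tau> a = (- real s) ^ n" "avoids s \<gamma> \<tau> a" and
    b: "pos s \<gamma> (- \<tau>) b = z + of_int k" "slope s \<gamma> (- \<tau>) b = (- real s) ^ n" "avoids s \<gamma> (- \<tau>) b" and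
    ab: "a = 0 \<longleftrightarrow> n = 0" "b \<ge> 1" "int a - int b = d"
    unfolding rung_def \<tau>_def by blast
  have "\<not> on_left s \<gamma> \<tau> a" using a z by (auto simp: on_left_def \<tau>_def)
  then have a': "pos s \<gamma> \<tau> (Suc a) = z' + of_int k'" "slope s \<gamma> \<tau> (Suc a) = (- real s) ^ Suc n"
    using a z' by (simp_all add: pos_Suc slope_Suc)
  have av_a: "avoids s \<gamma> \<tau> (Suc a)"
    using a z ab by (auto simp: avoids_def less_Suc_eq)
  have zk: "z + of_int k > \<gamma>" using z k by (smt (verit) of_int_1_le_iff)
  then have b': "pos s \<gamma> (- \<tau>) (Suc b) = 1 + real s * (1 - (z + of_int k))"
    "slope s \<gamma> (- \<tau>) (Suc b) = (- real s) ^ Suc n"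
    using b by (simp_all add: pos_Suc slope_Suc on_left_def)
  define t where "t = nat (int s * k - k')"
  have t: "int t = int s * k - k'" using k' by (simp add: t_def)
  then have "real t = real s * of_int k - of_int k'"
    by (metis of_int_diff of_int_mult of_int_of_nat_eq)
  then have "pos s \<gamma> (- \<tau>) (Suc b) = z' - real t"
    using b'(1) z'(1) by (simp add: algebra_simps)
  moreover have "avoids s \<gamma> (- \<tau>) (Suc b)"
    using b zk by (auto simp: avoids_def less_Suc_eq)
  ultimately have "pos s \<gamma> (- \<tau>) (Suc b + t) = z'" "slope s \<gamma> (- \<tau>) (Suc b + t) = (- real s) ^ Suc n"
    "avoids s \<gamma> (- \<tau>) (Suc b + t)"
    using translation_run[of s \<gamma> "- \<tau>" "Suc b" z' t] z'(2) b'(2) by auto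
  moreover have "int (Suc b + t) - int (Suc a) = int s * k - k' - d"
    using ab(3) t by simp
  moreover have "(-1) ^ Suc n = - \<tau>" "- ((-1) ^ Suc n) = \<tau>" by (simp_all add: \<tau>_def)
  ultimately show ?thesis
    unfolding rung_def using a' av_a
    by (intro exI[of _ "Suc b + t"] exI[of _ "Suc a"]) simp
qed

lemma rung_meet:
  assumes "rung s \<gamma> n z 0 d" "n \<ge> 1"
  obtains a b where "meet s \<gamma> a b" "a \<ge> 1" "b \<ge> 1" "avoids s \<gamma> (-1) a" "avoids s \<gamma> 1 b"
    "int b - int a = (-1) ^ n * d"
proof -
  from assms obtain a b where ab:
    "pos s \<gamma> ((-1) ^ n) a = z" "slope s \<gamma> ((-1) ^ n) a = (- real s) ^ n" "avoids s \<gamma> ((-1) ^ n) a"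
    "pos s \<gamma> (- ((-1) ^ n)) b = z" "slope s \<gamma> (- ((-1) ^ n)) b = (- real s) ^ n"
    "avoids s \<gamma> (- ((-1) ^ n)) b" "a \<ge> 1" "b \<ge> 1" "int a - int b = d"
    unfolding rung_def by auto
  show ?thesis
  proof (cases "even n")
    case True
    then show ?thesis using that[of b a] ab by (simp add: meet_def)
  next
    case False
    then show ?thesis using that[of a b] ab by (simp add: meet_def)
  qed
qed

text \<open>Modulo 1 both branches of \<open>Q\<close> act on the orbits of \<open>\<gamma>\<close> as multiplication by 1 and by \<open>- s\<close>, so after \<open>n\<close>
  expansions every position is congruent to this residue.\<close>

definition res :: "nat \<Rightarrow> real \<Rightarrow> nat \<Rightarrow> real" where
  "res s \<gamma> n = frac ((- real s) ^ n * \<gamma>)"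

lemma res_0: "0 < \<gamma> \<Longrightarrow> \<gamma> < 1 \<Longrightarrow> res s \<gamma> 0 = \<gamma>"
  by (simp add: res_def frac_eq)

text \<open>The height of the high germ above the low one after \<open>n\<close> expansions, if the low one is at the residue.
  It is written with floors to make it an integer; the geometric form is the next lemma. The value 1
  at \<open>n = 0\<close> comes from letting the left orbit make its first translation before the ladder starts.\<close>

definition gap :: "nat \<Rightarrow> real \<Rightarrow> nat \<Rightarrow> int" where
  "gap s \<gamma> n = (if n = 0 then 1
     else 1 + int s + int s * \<lfloor>(- real s) ^ (n - 1) * \<gamma>\<rfloor> + \<lfloor>(- real s) ^ n * \<gamma>\<rfloor>)"

lemma gap_Suc: "of_int (gap s \<gamma> (Suc n)) = 1 + real s - real s * res s \<gamma> n - res s \<gamma> (Suc n)"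
  by (simp add: gap_def res_def frac_def algebra_simps)

lemma res_bounds: "0 \<le> res s \<gamma> n" "res s \<gamma> n < 1"
  by (simp_all add: res_def frac_lt_1)

lemma gap_pos: "s \<ge> 1 \<Longrightarrow> gap s \<gamma> n \<ge> 1"
proof (cases n)
  case (Suc i)
  assume s: "s \<ge> 1"
  have "real s * res s \<gamma> i \<le> real s * 1"
    using res_bounds[of s \<gamma> i] by (intro mult_left_mono) auto
  then have "of_int (gap s \<gamma> n) > (0::real)"
    using gap_Suc[of s \<gamma> i] res_bounds[of s \<gamma> n] Suc by simp
  then show ?thesis by simp
qed (simp add: gap_def)

lemma gap_Suc_le:
  assumes s: "s \<ge> 1" and i: "res s \<gamma> i > 0"
  shows "gap s \<gamma> (Suc i) \<le> int s * gap s \<gamma> i"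
proof -
  have "real s * res s \<gamma> i > 0" using s i by simp
  then have "of_int (gap s \<gamma> (Suc i)) < (1 + int s :: real)"
    using gap_Suc[of s \<gamma> i] res_bounds[of s \<gamma> "Suc i"] by simp
  then have "gap s \<gamma> (Suc i) \<le> int s" by linarith
  also have "\<dots> \<le> int s * gap s \<gamma> i" using gap_pos[OF s, of \<gamma> i] s by simp
  finally show ?thesis .
qed

text \<open>Time of the low germ minus time of the high germ after \<open>n\<close> expansions. The closed form solves the
  recurrence of \<open>rung_Suc\<close>, in which \<open>lag + gap\<close> changes sign and gains \<open>(s + 1) * gap\<close>.\<close>

definition lag :: "nat \<Rightarrow> real \<Rightarrow> nat \<Rightarrow> int" where
  "lag s \<gamma> n = - ((-1) ^ n * (int s + 1) * (\<Sum>i<n. (-1) ^ i * gap s \<gamma> i)) - gap s \<gamma> n"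

lemma lag_Suc: "lag s \<gamma> (Suc n) = int s * gap s \<gamma> n - gap s \<gamma> (Suc n) - lag s \<gamma> n"
proof -
  have "(-1) ^ n * (-1) ^ n = (1::int)" by (simp flip: power_mult_distrib)
  then have "(-1) ^ n * ((-1) ^ n * x) = x" for x :: int by (simp flip: mult.assoc)
  then show ?thesis by (simp add: lag_def algebra_simps)
qed

lemma rung_res:
  assumes s: "s \<ge> 1" and \<gamma>: "0 < \<gamma>" "\<gamma> < 1"
    and above: "\<And>i. 1 \<le> i \<Longrightarrow> i \<le> n \<Longrightarrow> \<gamma> < res s \<gamma> i"
  shows "rung s \<gamma> n (res s \<gamma> n) (gap s \<gamma> n) (lag s \<gamma> n)"
  using above
proof (induction n)
  case 0
  have "res s \<gamma> 0 = \<gamma>" by (rule res_0[OF \<gamma>])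
  then show ?case using rung_0 by (simp add: gap_def lag_def)
next
  case (Suc n)
  have r0: "res s \<gamma> 0 = \<gamma>" by (rule res_0[OF \<gamma>])
  have z: "\<gamma> < res s \<gamma> n \<or> n = 0 \<and> res s \<gamma> n = \<gamma>"
    using Suc.prems[of n] r0 by (cases "n = 0") auto
  have IH: "rung s \<gamma> n (res s \<gamma> n) (gap s \<gamma> n) (lag s \<gamma> n)" using Suc by simp
  have "res s \<gamma> n > 0" using z \<gamma> by auto
  from rung_Suc[OF IH z gap_pos[OF s] _ _ gap_Suc_le[OF s this], of "res s \<gamma> (Suc n)"]
  show ?case
    using gap_Suc[of s \<gamma> n] res_bounds[of s \<gamma> "Suc n"] \<gamma> by (simp add: lag_Suc algebra_simps)
qed

text \<open>The low germ of the ladder is at the residue until the first residue below \<open>\<gamma>\<close>. There it is at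
  \<open>res m + 1 \<ge> 1\<close>, one above the residue, which diminishes the gap by 1. If nothing of the gap remains,
  the germs meet; otherwise expanding a point that is at least 1 gives a value at most 1, so
  the other germ reaches it by translations.\<close>

lemma meet_of_first_return:
  assumes s: "s \<ge> 1" and \<gamma>: "0 < \<gamma>" "\<gamma> < 1" and m: "m \<ge> 1"
    and above: "\<And>i. 1 \<le> i \<Longrightarrow> i < m \<Longrightarrow> \<gamma> < res s \<gamma> i"
    and below: "res s \<gamma> m < \<gamma>"
  obtains a b where "meet s \<gamma> a b" "a \<ge> 1" "b \<ge> 1" "avoids s \<gamma> (-1) a" "avoids s \<gamma> 1 b"
    "int b - int a = - (int s + 1) * ((\<Sum>i\<le>m. (-1) ^ i * gap s \<gamma> i) - (-1) ^ m)"
proof -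
  obtain n where n: "m = Suc n" using m by (cases m) auto
  have r0: "res s \<gamma> 0 = \<gamma>" by (rule res_0[OF \<gamma>])
  have zn: "\<gamma> < res s \<gamma> n \<or> n = 0 \<and> res s \<gamma> n = \<gamma>"
    using above[of n] r0 n by (cases "n = 0") auto
  then have pos: "res s \<gamma> n > 0" using \<gamma> by auto
  define z where "z = res s \<gamma> m + 1"
  define x where "x = 1 + real s * (1 - z)"
  have "rung s \<gamma> n (res s \<gamma> n) (gap s \<gamma> n) (lag s \<gamma> n)"
    using rung_res[OF s \<gamma>] above n by simp
  from rung_Suc[OF this zn gap_pos[OF s], of z "gap s \<gamma> m - 1"]
  have "rung s \<gamma> m z (gap s \<gamma> m - 1) (int s * gap s \<gamma> n - (gap s \<gamma> m - 1) - lag s \<gamma> n)"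
    using gap_Suc[of s \<gamma> n] below n gap_Suc_le[OF s pos] by (simp add: z_def algebra_simps)
  moreover have "int s * gap s \<gamma> n - (gap s \<gamma> m - 1) - lag s \<gamma> n = lag s \<gamma> m + 1"
    using lag_Suc[of s \<gamma> n] n by simp
  ultimately have top: "rung s \<gamma> m z (gap s \<gamma> m - 1) (lag s \<gamma> m + 1)"
    by (simp only:)
  have sq: "(-1) ^ m * ((-1) ^ m * x) = x" for x :: int
    by (simp flip: mult.assoc power_mult_distrib)
  show ?thesis
  proof (cases "gap s \<gamma> m = 1")
    case True
    have "(-1) ^ m * (lag s \<gamma> m + 1) = - (int s + 1) * ((\<Sum>i\<le>m. (-1) ^ i * gap s \<gamma> i) - (-1) ^ m)"
      using True sq by (simp add: lag_def algebra_simps flip: lessThan_Suc_atMost)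
    moreover have "rung s \<gamma> m z 0 (lag s \<gamma> m + 1)" using top True by simp
    from rung_meet[OF this m] obtain a b where "meet s \<gamma> a b" "a \<ge> 1" "b \<ge> 1"
      "avoids s \<gamma> (-1) a" "avoids s \<gamma> 1 b" "int b - int a = (-1) ^ m * (lag s \<gamma> m + 1)" .
    ultimately show ?thesis by (intro that) simp_all
  next
    case False
    then have "gap s \<gamma> m - 1 \<ge> 1" using gap_pos[OF s, of \<gamma> m] by simp
    have "0 \<le> real s * res s \<gamma> m" using res_bounds by simp
    then have "x < \<gamma> + 1" using \<gamma> by (simp add: x_def z_def)
    \<comment> \<open>One more expansion; here \<open>z' = x\<close> and \<open>k' = 0\<close>, that is, the low germ climbs all the way to the high one.\<close>
    from rung_Suc[OF top _ \<open>gap s \<gamma> m - 1 \<ge> 1\<close> _ this, of 0]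
    have end_rung: "rung s \<gamma> (Suc m) x 0 (int s * (gap s \<gamma> m - 1) - (lag s \<gamma> m + 1))"
      using res_bounds[of s \<gamma> m] \<gamma> \<open>gap s \<gamma> m - 1 \<ge> 1\<close> by (simp add: z_def x_def)
    have "(-1) ^ Suc m * (int s * (gap s \<gamma> m - 1) - (lag s \<gamma> m + 1)) =
        - (int s + 1) * ((\<Sum>i\<le>m. (-1) ^ i * gap s \<gamma> i) - (-1) ^ m)"
      using sq by (simp add: lag_def algebra_simps flip: lessThan_Suc_atMost)
    moreover from rung_meet[OF end_rung] obtain a b where "meet s \<gamma> a b" "a \<ge> 1" "b \<ge> 1"
      "avoids s \<gamma> (-1) a" "avoids s \<gamma> 1 b"
      "int b - int a = (-1) ^ Suc m * (int s * (gap s \<gamma> m - 1) - (lag s \<gamma> m + 1))"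
      by auto
    ultimately show ?thesis by (intro that) (simp_all only:)
  qed
qed

section \<open>Residues of s-adic parameters\<close>

lemma res_eqI: "0 \<le> (- real s) ^ n * \<gamma> - of_int q \<Longrightarrow> (- real s) ^ n * \<gamma> - of_int q < 1 \<Longrightarrow>
    res s \<gamma> n = (- real s) ^ n * \<gamma> - of_int q"
  unfolding res_def by (subst frac_unique_iff) (simp add: algebra_simps)

lemma res_add_period:
  assumes "res s \<gamma> j = \<gamma>"
  shows "res s \<gamma> (n + j) = res s \<gamma> n"
proof -
  define q where "q = \<lfloor>(- real s) ^ j * \<gamma>\<rfloor>"
  have "(- real s) ^ j * \<gamma> = \<gamma> + of_int q"
    using assms by (simp add: res_def frac_def q_def)
  then have "(- real s) ^ (n + j) * \<gamma> = (- real s) ^ n * \<gamma> + (- real s) ^ n * of_int q"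
    by (simp only: power_add mult.assoc distrib_left)
  also have "(- real s) ^ n * of_int q = of_int ((- int s) ^ n * q)" by simp
  finally show ?thesis unfolding res_def by (simp only: frac_add_of_int_right)
qed

lemma res_mod_period:
  assumes "res s \<gamma> j = \<gamma>"
  shows "res s \<gamma> n = res s \<gamma> (n mod j)"
proof -
  have "res s \<gamma> (r + k * j) = res s \<gamma> r" for r k
  proof (induction k)
    case (Suc k)
    then show ?case using res_add_period[OF assms, of "r + k * j"] by (simp add: algebra_simps)
  qed simp
  from this[of "n mod j" "n div j"] show ?thesis by simp
qed

lemma sadic_power_integer:
  assumes "x = real_of_int p / real s ^ e" "s \<ge> 1" "e \<le> n"
  shows "(- real s) ^ n * x \<in> \<int>"
proof -
  have "(- real s) ^ n * x = (- 1) ^ n * (real s ^ (n - e) * of_int p)"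
    using assms by (simp add: power_minus[of "real s"] power_diff)
  then show ?thesis by simp
qed

text \<open>Equality would make the residues periodic and so return to \<open>x\<close> forever, but the residues of an
  \<open>s\<close>-adic rational are eventually 0.\<close>

lemma res_sadic_neq:
  assumes s: "s \<ge> 1" and x: "sadic s x" "0 < x" "x < 1" and n: "n \<ge> 1"
  shows "res s x n \<noteq> x"
proof
  assume eq: "res s x n = x"
  obtain p e where pe: "x = real_of_int p / real s ^ e" using x by (auto simp: sadic_def)
  have "(- real s) ^ (e * n) * x \<in> \<int>"
    using sadic_power_integer[OF pe s, of "e * n"] n by simp
  then have "res s x (e * n) = 0" by (simp add: res_def)
  moreover have "res s x (e * n) = x"
    using res_mod_period[OF eq, of "e * n"] res_0 x by simp
  ultimately show False using x by simp
qed

lemma matching_set_of_first_return: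
  assumes s: "s \<ge> 2" and \<gamma>: "0 < \<gamma>" "\<gamma> < 1" and m: "m \<ge> 1"
    and above: "\<And>i. 1 \<le> i \<Longrightarrow> i < m \<Longrightarrow> \<gamma> < res s \<gamma> i"
    and below: "res s \<gamma> m < \<gamma>"
  shows "\<gamma> \<in> matching_set s"
proof -
  have "s \<ge> 1" using s by simp
  from meet_of_first_return[OF this \<gamma> m above below] obtain a b where
    "meet s \<gamma> a b" "a \<ge> 1" "b \<ge> 1" "avoids s \<gamma> (-1) a" "avoids s \<gamma> 1 b" by blast
  from matching_exponents_from_meet[OF s this] obtain km kp where
    "matching_exponents s \<gamma> km kp" "\<gamma> \<notin> prematching_set s \<gamma> km kp" .
  then show ?thesis by (auto simp: matching_set_def)
qed

lemma sadic_first_return: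
  assumes s: "s \<ge> 1" and x: "sadic s x" "0 < x" "x < 1"
    and e: "(- real s) ^ e * x \<in> \<int>"
  obtains m where "1 \<le> m" "m \<le> e" "\<And>i. 1 \<le> i \<Longrightarrow> i < m \<Longrightarrow> x < res s x i" "res s x m < x"
proof -
  define P where "P i \<longleftrightarrow> 1 \<le> i \<and> res s x i \<le> x" for i
  have "x \<notin> \<int>" using x by (auto elim!: Ints_cases)
  then have "e \<noteq> 0" using e by (cases "e = 0") auto
  moreover have "frac ((- real s) ^ e * x) = 0" using e by (simp only: frac_eq_0_iff)
  ultimately have "P e" using x by (simp only: P_def res_def) simp
  define m where "m = (LEAST i. P i)"
  have m: "P m" unfolding m_def using \<open>P e\<close> by (rule LeastI)
  have "m \<le> e" unfolding m_def using \<open>P e\<close> by (rule Least_le)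
  moreover have "x < res s x i" if "1 \<le> i" "i < m" for i
    using not_less_Least[of i P] that by (simp add: m_def P_def not_le)
  moreover have "res s x m < x" using m res_sadic_neq[OF s x, of m] by (simp add: P_def)
  ultimately show ?thesis using that m by (simp add: P_def)
qed

text \<open>The residue vanishes once the denominator is cleared, so there is a first residue that is at most \<open>x\<close>,
  and it is strictly smaller.\<close>

lemma sadic_in_matching_set:
  assumes s: "s \<ge> 2" and x: "sadic s x" "0 < x" "x < 1"
  shows "x \<in> matching_set s"
proof -
  obtain p e where pe: "x = real_of_int p / real s ^ e" using x by (auto simp: sadic_def)
  have "(- real s) ^ e * x \<in> \<int>" using sadic_power_integer[OF pe] s by simp
  have "s \<ge> 1" using s by simp
  from sadic_first_return[OF this x \<open>(- real s) ^ e * x \<in> \<int>\<close>] obtain m where m: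
    "1 \<le> m" "m \<le> e" "\<And>i. 1 \<le> i \<Longrightarrow> i < m \<Longrightarrow> x < res s x i" "res s x m < x"
    by blast
  show ?thesis by (rule matching_set_of_first_return[OF s x(2,3) m(1,3,4)])
qed

section \<open>The segment towards an s-adic rational of smaller denominator\<close>

lemma affine_root:
  fixes A B x y :: real
  assumes "A * x + B < 0" "0 \<le> A * y + B"
  obtains z where "z \<in> closed_segment x y" "A * z + B = 0"
proof -
  define c d where "c = A * x + B" and "d = A * y - A * x"
  have cd: "c < 0" "0 \<le> c + d" using assms by (simp_all add: c_def d_def)
  define t where "t = - c / d"
  have t: "0 \<le> t" "t \<le> 1" using cd by (simp_all add: t_def field_simps)
  have "c + t * d = 0" using cd by (simp add: t_def)
  then have "A * ((1 - t) * x + t * y) + B = 0" by (simp add: c_def d_def algebra_simps)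
  moreover have "(1 - t) * x + t * y \<in> closed_segment x y"
    using t by (auto simp: closed_segment_def)
  ultimately show ?thesis using that by blast
qed

text \<open>Let \<open>m\<close> be the first index at which the residue of \<open>\<xi>\<close> falls below \<open>\<xi>\<close>. The point \<open>center\<close> below is an
  \<open>s\<close>-adic rational with denominator dividing \<open>s ^ m\<close>, on the side of \<open>\<xi>\<close> where the residue decreases
  to 0. The aim is that the whole segment from \<open>\<xi>\<close> to \<open>center\<close> consists of matching parameters, so that
  \<open>center\<close> lies in the same component as \<open>\<xi>\<close>.\<close>

locale first_return =
  fixes s :: nat and \<xi> :: real and m :: nat
  assumes s: "s \<ge> 2" and \<xi>: "0 < \<xi>" "\<xi> < 1" and m: "m \<ge> 1"
    and above: "\<And>i. 1 \<le> i \<Longrightarrow> i < m \<Longrightarrow> \<xi> < res s \<xi> i"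
    and below: "res s \<xi> m < \<xi>"
begin

definition center :: real where
  "center = of_int \<lfloor>(- real s) ^ m * \<xi>\<rfloor> / (- real s) ^ m"

abbreviation offset :: "real \<Rightarrow> real" where
  "offset \<gamma> \<equiv> (- real s) ^ m * \<gamma> - of_int \<lfloor>(- real s) ^ m * \<xi>\<rfloor>"

lemma offset_center: "offset center = 0"
  using s by (simp add: center_def)

lemma offset_eq_0_iff: "offset \<gamma> = 0 \<longleftrightarrow> \<gamma> = center"
  using s by (auto simp: center_def field_simps)

lemma offset_segment:
  assumes "\<gamma> \<in> closed_segment \<xi> center"
  shows "0 < \<gamma>" "0 \<le> offset \<gamma>" "offset \<gamma> < \<gamma>" "offset \<gamma> < 1"
proof -
  from assms obtain t where t: "0 \<le> t" "t \<le> 1" "\<gamma> = (1 - t) * \<xi> + t * center"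
    by (auto simp: closed_segment_def)
  have off_\<xi>: "offset \<xi> = res s \<xi> m" by (simp add: res_def frac_def)
  have "offset \<gamma> = (1 - t) * offset \<xi> + t * offset center"
    unfolding t(3) by (simp add: algebra_simps)
  then have off: "offset \<gamma> = (1 - t) * res s \<xi> m" using offset_center off_\<xi> by simp
  have "center > 0"
  proof -
    have "1 \<le> real s ^ m" using s by (intro one_le_power) auto
    then have "\<bar>\<xi> - center\<bar> * 1 \<le> \<bar>\<xi> - center\<bar> * real s ^ m"
      by (intro mult_left_mono) auto
    also have "\<dots> = \<bar>(\<xi> - center) * (- real s) ^ m\<bar>"
      by (simp add: abs_mult power_abs)
    also have "(\<xi> - center) * (- real s) ^ m = offset \<xi> - offset center"
      by (simp add: algebra_simps)
    also have "\<bar>\<dots>\<bar> = res s \<xi> m" using off_\<xi> offset_center res_bounds(1)[of s \<xi> m] by simp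
    finally have "\<bar>\<xi> - center\<bar> \<le> res s \<xi> m" by simp
    then show ?thesis using below by linarith
  qed
  have "(1 - t) * res s \<xi> m < (1 - t) * \<xi> + t * center \<and> 0 < (1 - t) * \<xi> + t * center"
  proof (cases "t = 1")
    case True
    then show ?thesis using \<open>center > 0\<close> by simp
  next
    case False
    then have "(1 - t) * res s \<xi> m < (1 - t) * \<xi>" "0 \<le> t * center" "0 < (1 - t) * \<xi>"
      using t below \<open>center > 0\<close> \<xi> by auto
    then show ?thesis by linarith
  qed
  then show "0 < \<gamma>" "offset \<gamma> < \<gamma>" using off t by auto
  show "0 \<le> offset \<gamma>" using off t res_bounds by simp
  have "(1 - t) * res s \<xi> m \<le> 1 * res s \<xi> m" using t res_bounds by (intro mult_right_mono) auto
  then show "offset \<gamma> < 1" using off res_bounds[of s \<xi> m] by simp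
qed

text \<open>On the segment \<open>offset\<close> takes values in \<open>{0..<1}\<close>, so it is an integer only where it vanishes.\<close>

lemma integer_in_segment:
  assumes "\<theta> \<in> closed_segment \<xi> center" "(- real s) ^ j * \<theta> \<in> \<int>" "j \<le> m"
  shows "\<theta> = center"
proof -
  have "(- real s) ^ m * \<theta> = (- real s) ^ (m - j) * ((- real s) ^ j * \<theta>)"
    using assms(3) by (simp flip: power_add mult.assoc)
  also have "\<dots> \<in> \<int>" by (intro Ints_mult Ints_power Ints_minus Ints_of_nat assms(2))
  finally have "offset \<theta> \<in> \<int>" by (intro Ints_diff Ints_of_int)
  then obtain i :: int where "offset \<theta> = of_int i" by (rule Ints_cases)
  then have "offset \<theta> = 0" using offset_segment[OF assms(1)] by simp
  then show ?thesis by (simp only: offset_eq_0_iff)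
qed

lemma segment_between:
  assumes "\<gamma> \<in> closed_segment \<xi> center" "\<gamma> \<noteq> center" "\<theta> \<in> closed_segment \<xi> \<gamma>"
  shows "\<theta> \<in> closed_segment \<xi> center" "\<theta> \<noteq> center"
  using assms by (auto simp: closed_segment_eq_real_ivl split: if_splits)

lemma segment_less_1:
  assumes "\<gamma> \<in> closed_segment \<xi> center" "\<gamma> \<noteq> center"
  shows "\<gamma> < 1"
proof (rule ccontr)
  assume "\<not> \<gamma> < 1"
  then have "1 \<in> closed_segment \<xi> \<gamma>" using \<xi> by (simp add: closed_segment_eq_real_ivl)
  from segment_between[OF assms this] integer_in_segment[of 1 0] show False by simp
qed

lemma segment_below:
  assumes "\<gamma> \<in> closed_segment \<xi> center"
  shows "res s \<gamma> m < \<gamma>"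
  using offset_segment[OF assms] res_eqI[of s m \<gamma> "\<lfloor>(- real s) ^ m * \<xi>\<rfloor>"] by simp

text \<open>The first return time cannot drop to some \<open>j < m\<close> on the way from \<open>\<xi>\<close> to a point \<open>\<gamma>\<close> before \<open>center\<close>.
  For a drop, the affine function \<open>(- s) ^ j * x - q\<close> would have to enter the range from \<open>0\<close> to \<open>x\<close>
  between \<open>\<xi>\<close> and \<open>\<gamma>\<close>. Entering at the value 0 gives a point that \<open>(- s) ^ j\<close> makes an integer, and
  \<open>center\<close> is the only such point. Entering at the value \<open>x\<close> gives a point with \<open>j\<close>-periodic residues;
  its residue at \<open>m\<close> is also the one at \<open>m mod j\<close>, so an even earlier drop occurs there, and
  induction on \<open>j\<close> excludes it.\<close>

lemma segment_above:
  assumes "\<gamma> \<in> closed_segment \<xi> center" "\<gamma> \<noteq> center" "1 \<le> j" "j < m"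
  shows "\<gamma> < res s \<gamma> j"
  using assms
proof (induction j arbitrary: \<gamma> rule: less_induct)
  case (less j)
  show ?case
  proof (rule ccontr)
    assume "\<not> \<gamma> < res s \<gamma> j"
    define q where "q = \<lfloor>(- real s) ^ j * \<gamma>\<rfloor>"
    have H: "0 \<le> (- real s) ^ j * \<gamma> - of_int q" "(- real s) ^ j * \<gamma> - of_int q \<le> \<gamma>"
      using \<open>\<not> \<gamma> < res s \<gamma> j\<close> by (simp_all add: res_def frac_def q_def)
    have "(- real s) ^ j * \<xi> - of_int q < 0 \<or> (- real s) ^ j * \<xi> - of_int q > \<xi>"
      using above[of j] less.prems res_eqI[of s j \<xi> q] \<xi> by fastforce
    then show False
    proof
      assume "(- real s) ^ j * \<xi> - of_int q < 0"
      then obtain \<theta> where \<theta>: "\<theta> \<in> closed_segment \<xi> \<gamma>" "(- real s) ^ j * \<theta> - of_int q = 0"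
        using affine_root[of "(- real s) ^ j" \<xi> "- of_int q" \<gamma>] H by auto
      then have "(- real s) ^ j * \<theta> = of_int q" by simp
      then have "(- real s) ^ j * \<theta> \<in> \<int>" by (metis Ints_of_int)
      then show False
        using integer_in_segment segment_between[OF less.prems(1,2) \<theta>(1)] less.prems by auto
    next
      assume "(- real s) ^ j * \<xi> - of_int q > \<xi>"
      then obtain \<theta> where \<theta>: "\<theta> \<in> closed_segment \<xi> \<gamma>" "(1 - (- real s) ^ j) * \<theta> + of_int q = 0"
        using affine_root[of "1 - (- real s) ^ j" \<xi> "of_int q" \<gamma>] H
        by (auto simp: algebra_simps)
      note seg = segment_between[OF less.prems(1,2) \<theta>(1)]
      have \<theta>01: "0 < \<theta>" "\<theta> < 1" using offset_segment(1) segment_less_1 seg by auto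
      have fixed: "res s \<theta> j = \<theta>"
        using \<theta>(2) \<theta>01 res_eqI[of s j \<theta> q] by (simp add: algebra_simps)
      have "res s \<theta> (m mod j) < \<theta>"
        using segment_below[OF seg(1)] res_mod_period[OF fixed, of m] by simp
      moreover have "m mod j < j" using less.prems by simp
      moreover have "\<theta> < res s \<theta> (m mod j)" if "m mod j \<noteq> 0"
        using less.IH[OF \<open>m mod j < j\<close> seg] that \<open>m mod j < j\<close> less.prems by simp
      ultimately show False
        using res_0[OF \<theta>01, of s] by (cases "m mod j = 0") auto
    qed
  qed
qed

text \<open>Up to \<open>center\<close> the return time is \<open>m\<close> with a strict inequality; \<open>center\<close> itself may return
  earlier, but it is \<open>s\<close>-adic. The segment does not cross the right end \<open>s / (s + 1)\<close> because that
  point equals its own residue at 1.\<close>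

lemma segment_in_matching_set:
  assumes "\<xi> \<le> real s / (real s + 1)"
  shows "closed_segment \<xi> center \<subseteq> {0..real s / (real s + 1)} \<inter> matching_set s"
proof -
  define \<theta> where "\<theta> = real s / (real s + 1)"
  have \<theta>: "0 < \<theta>" "\<theta> < 1" "- real s * \<theta> = \<theta> - real s" using s by (simp_all add: \<theta>_def field_simps)
  have "res s \<theta> 1 = \<theta>"
    using res_eqI[of s 1 \<theta> "- int s"] \<theta> by simp
  then have "\<not> (\<theta> \<in> closed_segment \<xi> center \<and> \<theta> \<noteq> center)"
    using segment_above[of \<theta> 1] segment_below[of \<theta>] m by (cases "m = 1") auto
  then have "center \<le> \<theta>"
    using assms by (auto simp: closed_segment_eq_real_ivl \<theta>_def split: if_splits)
  then have le: "\<gamma> \<le> \<theta>" if "\<gamma> \<in> closed_segment \<xi> center" for \<gamma>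
    using that assms by (auto simp: closed_segment_eq_real_ivl \<theta>_def split: if_splits)
  have "\<gamma> \<in> matching_set s" if \<gamma>: "\<gamma> \<in> closed_segment \<xi> center" for \<gamma>
  proof (cases "\<gamma> = center")
    case True
    have "center = of_int ((- 1) ^ m * \<lfloor>(- real s) ^ m * \<xi>\<rfloor>) / real s ^ m"
      by (simp add: center_def power_minus[of "real s"] divide_simps)
    then have "sadic s \<gamma>" unfolding sadic_def True by blast
    then show ?thesis using sadic_in_matching_set s offset_segment(1)[OF \<gamma>] le[OF \<gamma>] \<theta> by simp
  next
    case False
    show ?thesis
      using matching_set_of_first_return[OF s offset_segment(1)[OF \<gamma>] segment_less_1[OF \<gamma> False] m
          segment_above[OF \<gamma> False] segment_below[OF \<gamma>]] .
  qed
  moreover have "0 \<le> \<gamma>" if "\<gamma> \<in> closed_segment \<xi> center" for \<gamma>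
    using offset_segment(1)[OF that] by simp
  ultimately show ?thesis using le by (auto simp: \<theta>_def)
qed

end

text \<open>Let \<open>s ^ e\<close> be the denominator of \<open>\<xi>\<close>. The residue at \<open>e\<close> is 0, so the first return time is at most \<open>e\<close>.
  If it were smaller, the center of that return would lie in \<open>V\<close> and have a smaller denominator.\<close>

lemma pseudocenter_first_return:
  assumes s: "s \<ge> 2" and V: "V \<in> components ({0..real s / (real s + 1)} - bifurcation_set s)"
    and pc: "is_pseudocenter s V \<xi>"
  obtains e where "e \<ge> 1" "0 < \<xi>" "\<xi> < 1" "(- real s) ^ e * \<xi> \<in> \<int>"
    "\<And>i. 1 \<le> i \<Longrightarrow> i < e \<Longrightarrow> \<xi> < res s \<xi> i" "res s \<xi> e < \<xi>"
proof -
  have dom: "{0..real s / (real s + 1)} - bifurcation_set s = {0..real s / (real s + 1)} \<inter> matching_set s"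
    by (auto simp: bifurcation_set_def)
  have \<xi>V: "\<xi> \<in> V" and sad: "sadic s \<xi>" using pc by (auto simp: is_pseudocenter_def)
  have "\<xi> \<in> {0..real s / (real s + 1)} \<inter> matching_set s"
    using in_components_subset[OF V] \<xi>V unfolding dom by (rule subsetD)
  then have "0 \<le> \<xi>" "\<xi> \<le> real s / (real s + 1)" "\<xi> \<in> matching_set s" by simp_all
  moreover have "real s / (real s + 1) < 1" by simp
  moreover have "\<xi> \<noteq> 0" using \<open>\<xi> \<in> matching_set s\<close> zero_notin_matching_set[OF s] by blast
  ultimately have bounds: "0 < \<xi>" "\<xi> < 1" "\<xi> \<le> real s / (real s + 1)" by linarith+
  define E where "E m \<longleftrightarrow> (\<exists>p::int. \<xi> = real_of_int p / real s ^ m)" for m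
  define e where "e = (LEAST m. E m)"
  have "\<exists>m. E m" using sad by (auto simp: sadic_def E_def)
  then have "E e" unfolding e_def by (rule LeastI_ex)
  then obtain p :: int where p: "\<xi> = real_of_int p / real s ^ e" by (auto simp: E_def)
  have int_e: "(- real s) ^ e * \<xi> \<in> \<int>" using sadic_power_integer[OF p, of e] s by simp
  have "s \<ge> 1" using s by simp
  from sadic_first_return[OF this sad bounds(1,2) int_e] obtain m where first: "1 \<le> m" "m \<le> e"
    "\<And>i. 1 \<le> i \<Longrightarrow> i < m \<Longrightarrow> \<xi> < res s \<xi> i" "res s \<xi> m < \<xi>"
    by blast
  interpret first_return s \<xi> m
    using s bounds first by unfold_locales auto
  have "closed_segment \<xi> center \<subseteq> V"
    using components_maximal[OF V, of "closed_segment \<xi> center"] segment_in_matching_set[OF bounds(3)] \<xi>V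
    unfolding dom by auto
  then have "center \<in> V" by auto
  define q where "q = (- 1) ^ m * \<lfloor>(- real s) ^ m * \<xi>\<rfloor>"
  have c: "center = of_int q / real s ^ m"
    by (simp add: center_def q_def power_minus[of "real s"] divide_simps)
  then have "sadic s center" by (auto simp: sadic_def)
  then have "sadic_denom s \<xi> \<le> sadic_denom s center"
    using pc \<open>center \<in> V\<close> by (auto simp: is_pseudocenter_def)
  then have "s ^ e \<le> s ^ (LEAST m. \<exists>p::int. center = of_int p / real s ^ m)"
    by (simp add: sadic_denom_def e_def E_def)
  then have "e \<le> (LEAST m. \<exists>p::int. center = of_int p / real s ^ m)"
    using s by (simp add: power_le_imp_le_exp)
  also have "\<dots> \<le> m" using c by (blast intro: Least_le)
  finally have "m = e" using first(2) by simp
  with first int_e show ?thesis by (intro that[of m] bounds(1,2)) simp_all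
qed

section \<open>Words and their digits\<close>

lemma word_val_Nil [simp]: "word_val s [] = 0"
  by (simp add: word_val_def)

lemma word_val_Cons: "word_val s (x # u) = (real x + word_val s u) / real s"
proof -
  have "word_val s (x # u) = real x / real s + (\<Sum>i<length u. real (u ! i) / real s ^ (i + 2))"
    unfolding word_val_def length_Cons sum.lessThan_Suc_shift by simp
  also have "(\<Sum>i<length u. real (u ! i) / real s ^ (i + 2)) = word_val s u / real s"
    unfolding word_val_def sum_divide_distrib by (rule sum.cong) (simp_all add: mult.commute)
  finally show ?thesis by (simp add: add_divide_distrib)
qed

lemma word_val_bounds:
  assumes "s \<ge> 1" "set u \<subseteq> {..<s}"
  shows "0 \<le> word_val s u \<and> word_val s u < 1"
  using assms(2)
proof (induction u)
  case (Cons x u)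
  then have "real x + 1 \<le> real s" by (simp add: Suc_leI flip: of_nat_Suc)
  then have "real x + word_val s u < real s" using Cons by simp
  then show ?case using Cons assms(1) by (simp add: word_val_Cons)
qed simp

lemma word_val_eq_0:
  assumes "s \<ge> 1" "word_val s u = 0" "set u \<subseteq> {..<s}" "x \<in> set u"
  shows "x = 0"
  using assms
proof (induction u)
  case (Cons y u)
  then have "0 \<le> word_val s u" using word_val_bounds by simp
  moreover have "real y + word_val s u = 0" using Cons.prems by (simp add: word_val_Cons)
  ultimately have "y = 0" "word_val s u = 0" by linarith+
  then show ?case using Cons by auto
qed simp

lemma word_val_shift:
  assumes "s \<ge> 1" "set w \<subseteq> {..<s}" "n \<le> length w"
  shows "\<exists>q::int. real s ^ n * word_val s w = of_int q + word_val s (drop n w)"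
  using assms(3)
proof (induction n)
  case 0
  then show ?case by (auto intro: exI[of _ 0])
next
  case (Suc n)
  then obtain q :: int where q: "real s ^ n * word_val s w = of_int q + word_val s (drop n w)"
    by auto
  have "drop n w = w ! n # drop (Suc n) w" using Suc.prems by (simp add: Cons_nth_drop_Suc)
  then have "real s * word_val s (drop n w) = real (w ! n) + word_val s (drop (Suc n) w)"
    using assms(1) by (simp add: word_val_Cons)
  then have "real s ^ Suc n * word_val s w
      = of_int (int s * q + int (w ! n)) + word_val s (drop (Suc n) w)"
    using q by (simp add: algebra_simps)
  then show ?case by blast
qed

text \<open>The integer part of \<open>s ^ n\<close> times a word's value is the number spelled by the first \<open>n\<close> letters, the
  fractional part is the value of the remaining word.\<close>

lemma floor_shift:
  assumes "s \<ge> 1" "set w \<subseteq> {..<s}" "n \<le> length w"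
  shows "real s ^ n * word_val s w = of_int \<lfloor>real s ^ n * word_val s w\<rfloor> + word_val s (drop n w)"
proof -
  obtain q :: int where q: "real s ^ n * word_val s w = of_int q + word_val s (drop n w)"
    using word_val_shift[OF assms] by blast
  have "set (drop n w) \<subseteq> {..<s}" using assms(2) set_drop_subset by fast
  from word_val_bounds[OF assms(1) this] have "\<lfloor>real s ^ n * word_val s w\<rfloor> = q"
    unfolding q by (simp add: floor_eq_iff)
  then show ?thesis using q by simp
qed

lemma floor_shift_Suc:
  assumes "s \<ge> 1" "set w \<subseteq> {..<s}" "n < length w"
  shows "\<lfloor>real s ^ Suc n * word_val s w\<rfloor> = int s * \<lfloor>real s ^ n * word_val s w\<rfloor> + int (w ! n)"
proof -
  have "drop n w = w ! n # drop (Suc n) w" using assms(3) by (simp add: Cons_nth_drop_Suc)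
  then have "real s * word_val s (drop n w) = real (w ! n) + word_val s (drop (Suc n) w)"
    using assms(1) by (simp add: word_val_Cons)
  moreover have "real s * (real s ^ n * word_val s w)
      = real s * of_int \<lfloor>real s ^ n * word_val s w\<rfloor> + real s * word_val s (drop n w)"
    using arg_cong[OF floor_shift[OF assms(1,2) less_imp_le[OF assms(3)]], of "(*) (real s)"]
    by (simp only: distrib_left)
  moreover have "real s * (real s ^ n * word_val s w)
      = of_int \<lfloor>real s ^ Suc n * word_val s w\<rfloor> + word_val s (drop (Suc n) w)"
    using floor_shift[OF assms(1,2) Suc_leI[OF assms(3)]] by (simp only: power_Suc mult.assoc)
  ultimately have "real s * of_int \<lfloor>real s ^ n * word_val s w\<rfloor> + real (w ! n)
      = of_int \<lfloor>real s ^ Suc n * word_val s w\<rfloor>"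
    by linarith
  then have "real_of_int (int s * \<lfloor>real s ^ n * word_val s w\<rfloor> + int (w ! n))
      = of_int \<lfloor>real s ^ Suc n * word_val s w\<rfloor>" by simp
  then show ?thesis by (simp only: of_int_eq_iff)
qed

lemma ex_word_of_length:
  assumes "P < s ^ n"
  shows "\<exists>u. length u = n \<and> set u \<subseteq> {..<s} \<and> word_val s u = real P / real s ^ n"
  using assms
proof (induction n arbitrary: P)
  case 0
  then show ?case by auto
next
  case (Suc n)
  then have s: "s > 0" by (cases s) auto
  then have "P mod s ^ n < s ^ n" by simp
  from Suc.IH[OF this] obtain u where
    u: "length u = n" "set u \<subseteq> {..<s}" "word_val s u = real (P mod s ^ n) / real s ^ n" by blast
  have "P div s ^ n < s" using Suc.prems by (simp add: less_mult_imp_div_less mult.commute)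
  moreover have "real P = real (P div s ^ n) * real s ^ n + real (P mod s ^ n)"
    by (metis div_mult_mod_eq of_nat_add of_nat_mult of_nat_power)
  then have "word_val s (P div s ^ n # u) = real P / real s ^ Suc n"
    using u(3) s by (simp add: word_val_Cons field_simps)
  ultimately show ?case using u by (intro exI[of _ "P div s ^ n # u"]) simp
qed

lemma word_norm_eq:
  assumes "set w \<subseteq> {..<s}"
  shows "word_norm s w = (int s - 1) * int (length w) - 2 * (\<Sum>i<length w. int (w ! i))"
  using assms
proof (induction w)
  case Nil
  then show ?case by (simp add: word_norm_def)
next
  case (Cons x u)
  have "word_norm s (x # u) = (\<Sum>j<s. (int s - 1 - 2 * int j) * int (count_list u j)
      + (if x = j then int s - 1 - 2 * int j else 0))"
    unfolding word_norm_def by (rule sum.cong) (auto simp: algebra_simps)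
  also have "\<dots> = word_norm s u + (int s - 1 - 2 * int x)"
    using Cons.prems by (simp add: sum.distrib word_norm_def)
  finally show ?case using Cons
    by (simp add: sum.lessThan_Suc_shift algebra_simps del: sum.lessThan_Suc)
qed

lemma shortest_even_expansion_length:
  assumes s: "s \<ge> 1" and w: "shortest_even_expansion s w \<xi>"
    and e: "(- real s) ^ e * \<xi> \<in> \<int>"
  shows "length w \<le> e + 1"
proof -
  define n where "n = (if even e then e else e + 1)"
  have n: "even n" "e \<le> n" "n \<le> e + 1" by (auto simp: n_def)
  have val: "word_val s w = \<xi>" and sub: "set w \<subseteq> {..<s}"
    using w by (auto simp: shortest_even_expansion_def even_expansion_def)
  have sn: "real s ^ n = real s ^ (n - e) * real s ^ e" using n(2) by (simp flip: power_add)
  have se: "(- real s) ^ e = (- 1) ^ e * real s ^ e" by (rule power_minus)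
  have "(- 1) ^ e * real s ^ (n - e) * ((- real s) ^ e * \<xi>) =
      ((- 1) ^ e * (- 1) ^ e) * (real s ^ n * \<xi>)"
    unfolding sn se by (simp only: ac_simps)
  also have "(- 1) ^ e * (- 1) ^ e = (1::real)" by (cases "even e") simp_all
  finally have "(- 1) ^ e * real s ^ (n - e) * ((- real s) ^ e * \<xi>) = real s ^ n * \<xi>"
    by (simp only: mult_1_left)
  moreover have "(- 1) ^ e * real s ^ (n - e) * ((- real s) ^ e * \<xi>) \<in> \<int>"
    using e by (rule Ints_mult[rotated]) simp
  ultimately have "real s ^ n * \<xi> \<in> \<int>" by (simp only:)
  then obtain p where p: "real s ^ n * \<xi> = of_int p" by (elim Ints_cases)
  have \<xi>: "0 \<le> \<xi>" "\<xi> < 1" using word_val_bounds[OF s sub] val by auto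
  have "0 \<le> real_of_int p" using \<xi> unfolding p[symmetric] by simp
  then have "0 \<le> p" by simp
  have "real_of_int p < real s ^ n" using \<xi> s unfolding p[symmetric] by simp
  then have "real (nat p) < real (s ^ n)" using \<open>0 \<le> p\<close> by simp
  then have "nat p < s ^ n" by (simp only: of_nat_less_iff)
  from ex_word_of_length[OF this] obtain u where
    u: "length u = n" "set u \<subseteq> {..<s}" "word_val s u = real (nat p) / real s ^ n" by blast
  have "real (nat p) / real s ^ n = \<xi>"
    using p \<open>0 \<le> p\<close> s by (simp add: field_simps)
  then have "even_expansion s u \<xi>" using u n by (simp add: even_expansion_def)
  then show ?thesis using w u n by (auto simp: shortest_even_expansion_def)
qed

lemma floor_neg_power:
  "\<lfloor>(- real s) ^ n * x\<rfloor> = (if even n then \<lfloor>real s ^ n * x\<rfloor>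
     else if real s ^ n * x \<in> \<int> then - \<lfloor>real s ^ n * x\<rfloor> else - \<lfloor>real s ^ n * x\<rfloor> - 1)"
proof (cases "even n")
  case False
  then have "(- real s) ^ n * x = - (real s ^ n * x)" by simp
  moreover have "\<lfloor>- y\<rfloor> = (if y \<in> \<int> then - \<lfloor>y\<rfloor> else - \<lfloor>y\<rfloor> - 1)" for y :: real
  proof (cases "y \<in> \<int>")
    case False
    then have "y \<noteq> of_int \<lfloor>y\<rfloor>" by (metis Ints_of_int)
    then show ?thesis using False by (simp add: floor_minus ceiling_altdef)
  qed (auto elim: Ints_cases)
  ultimately show ?thesis using False by simp
qed simp

text \<open>For odd \<open>n\<close> below \<open>e\<close> the gap is \<open>s\<close> minus the \<open>n\<close>-th digit, for even \<open>n\<close> it is 1 plus that digit.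
  The correction at \<open>n = e\<close>, odd, arises because the residue there is 0 while the usual
  passage from \<open>- x\<close> to the complement of the fractional part of \<open>x\<close> would give 1.\<close>

lemma gap_digit:
  assumes s: "s \<ge> 1" and w: "set w \<subseteq> {..<s}" and \<xi>: "word_val s w = \<xi>"
    and n: "1 \<le> n" "n \<le> e" "e \<le> length w"
    and nonint: "\<And>i. 1 \<le> i \<Longrightarrow> i < e \<Longrightarrow> real s ^ i * \<xi> \<notin> \<int>" and int: "real s ^ e * \<xi> \<in> \<int>"
  shows "(-1) ^ n * gap s \<xi> n = int (w ! (n - 1)) +
    (if even n then 1 else - int s) - (if odd n \<and> n = e then 1 else 0)"
proof -
  obtain i where i: "n = Suc i" using n by (cases n) auto
  define F where "F = (\<lambda>n. \<lfloor>real s ^ n * \<xi>\<rfloor>)"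
  have digit: "F n = int s * F i + int (w ! i)"
    using floor_shift_Suc[OF s w, of i] i n unfolding F_def \<xi> by simp
  have G: "\<lfloor>(- real s) ^ k * \<xi>\<rfloor> = (if even k then F k else if k = e then - F k else - F k - 1)"
    if "k \<le> e" for k
    using nonint[of k] int that unfolding F_def floor_neg_power by (cases "k = 0") auto
  have "i < e" "i \<le> e" using i n by auto
  have "gap s \<xi> n = 1 + int s + int s * \<lfloor>(- real s) ^ i * \<xi>\<rfloor> + \<lfloor>(- real s) ^ n * \<xi>\<rfloor>"
    by (simp add: gap_def i)
  also have "\<dots> = (if even n then 1 + int (w ! i) else int s - int (w ! i) + (if n = e then 1 else 0))"
    using G[OF n(2)] G[OF \<open>i \<le> e\<close>] digit \<open>i < e\<close> i by (auto simp: algebra_simps)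
  finally show ?thesis using i by auto
qed

text \<open>Two consecutive digits contribute their sum and \<open>- (s - 1)\<close>. A shortest even word has length \<open>e\<close> or
  \<open>e + 1\<close>; in the second case its last digit is 0, and the correction at the odd index \<open>e\<close> accounts for
  the half pair.\<close>

lemma gap_sum:
  assumes s: "s \<ge> 2" and w: "shortest_even_expansion s w \<xi>" and \<xi>: "0 < \<xi>" and e: "e \<ge> 1"
    and above: "\<And>i. 1 \<le> i \<Longrightarrow> i < e \<Longrightarrow> \<xi> < res s \<xi> i" and int: "(- real s) ^ e * \<xi> \<in> \<int>"
  shows "word_norm s w = - 2 * ((\<Sum>i\<le>e. (-1) ^ i * gap s \<xi> i) - (-1) ^ e)"
proof -
  have s1: "s \<ge> 1" using s by simp
  have val: "word_val s w = \<xi>" and sub: "set w \<subseteq> {..<s}" and even_w: "even (length w)"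
    using w by (auto simp: shortest_even_expansion_def even_expansion_def)
  have pm: "(- real s) ^ i * \<xi> = (- 1) ^ i * (real s ^ i * \<xi>)" for i
    by (simp add: power_minus[of "real s"])
  have nonint: "real s ^ i * \<xi> \<notin> \<int>" if "1 \<le> i" "i < e" for i
  proof
    assume "real s ^ i * \<xi> \<in> \<int>"
    then have "(- real s) ^ i * \<xi> \<in> \<int>" unfolding pm by (rule Ints_mult[rotated]) simp
    then have "res s \<xi> i = 0" by (simp only: res_def frac_eq_0_iff)
    then show False using above[OF that] \<xi> by simp
  qed
  have int': "real s ^ e * \<xi> \<in> \<int>"
    using int unfolding pm by (cases "even e") auto
  have le: "length w \<le> e + 1" by (rule shortest_even_expansion_length[OF s1 w int])
  have ge: "e \<le> length w"
  proof (rule ccontr)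
    assume "\<not> e \<le> length w"
    moreover have "real s ^ length w * \<xi> \<in> \<int>"
      using word_val_shift[OF s1 sub order_refl] val by auto
    ultimately show False using nonint[of "length w"] val \<xi> by (cases "length w = 0") auto
  qed
  have len: "length w = 2 * ((e + 1) div 2)"
    using even_w le ge by presburger
  have digits: "(\<Sum>i<length w. int (w ! i)) = (\<Sum>i<e. int (w ! i))"
  proof -
    have "w ! i = 0" if "i \<ge> e" "i < length w" for i
    proof -
      have "word_val s (drop e w) = 0"
        using floor_shift[OF s1 sub ge] int' val by (auto elim!: Ints_cases)
      moreover have "set (drop e w) \<subseteq> {..<s}" using sub set_drop_subset by fast
      moreover have "w ! i \<in> set (drop e w)" using that nth_mem[of "i - e" "drop e w"] by simp
      ultimately show ?thesis using word_val_eq_0 s1 by blast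
    qed
    then show ?thesis using ge by (intro sum.mono_neutral_right) auto
  qed
  have sum_pairs: "1 + (\<Sum>i<n. (if odd i then 1 else - int s)) - (if even n then 1 else 0)
      = - ((int s - 1) * int ((n + 1) div 2))" for n
  proof (induction n)
    case (Suc n)
    show ?case
    proof (cases "even n")
      case True
      then obtain h where "n = 2 * h" by (rule evenE)
      then show ?thesis using Suc by (simp add: algebra_simps)
    next
      case False
      then obtain h where "n = 2 * h + 1" by (rule oddE)
      then show ?thesis using Suc by (simp add: algebra_simps)
    qed
  qed simp
  have "(\<Sum>i\<le>e. (-1) ^ i * gap s \<xi> i) = 1 + (\<Sum>i<e. (-1) ^ Suc i * gap s \<xi> (Suc i))"
    unfolding sum.atMost_shift by (simp add: gap_def)
  also have "(\<Sum>i<e. (-1) ^ Suc i * gap s \<xi> (Suc i)) = (\<Sum>i<e. int (w ! i) +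
      (if odd i then 1 else - int s) - (if odd e \<and> i = e - 1 then 1 else 0))"
  proof (rule sum.cong)
    fix i assume "i \<in> {..<e}"
    then show "(-1) ^ Suc i * gap s \<xi> (Suc i) = int (w ! i) +
        (if odd i then 1 else - int s) - (if odd e \<and> i = e - 1 then 1 else 0)"
      using gap_digit[OF s1 sub val _ _ ge nonint int', of "Suc i"] by auto
  qed simp
  also have "\<dots> = (\<Sum>i<e. int (w ! i)) + (\<Sum>i<e. if odd i then 1 else - int s) - (if odd e then 1 else 0)"
    using e by (simp add: sum.distrib sum_subtractf)
  finally have "(\<Sum>i\<le>e. (-1) ^ i * gap s \<xi> i) - (-1) ^ e
      = (\<Sum>i<e. int (w ! i)) - (int s - 1) * int ((e + 1) div 2)"
    using sum_pairs[of e] by auto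
  then show ?thesis
    unfolding word_norm_eq[OF sub] digits by (simp add: len algebra_simps)
qed

section \<open>The matching index of a component\<close>

theorem theorem6:
  fixes s :: nat and V :: "real set" and \<xi> :: real and w :: "nat list"
  assumes "s \<ge> 2"
    and "V \<in> components ({0 .. real s / (real s + 1)} - bifurcation_set s)"
    and "is_pseudocenter s V \<xi>"
    and "shortest_even_expansion s w \<xi>"
  shows "\<exists>\<Delta>::int. has_matching_index s V \<Delta> \<and>
           real_of_int \<Delta> = (real s + 1) / 2 * real_of_int (word_norm s w) \<and>
           (int s + 1) dvd \<Delta>"
proof -
  have s1: "s \<ge> 1" using assms(1) by simp
  obtain e where e: "e \<ge> 1" "0 < \<xi>" "\<xi> < 1" "(- real s) ^ e * \<xi> \<in> \<int>"
    and above: "\<And>i. 1 \<le> i \<Longrightarrow> i < e \<Longrightarrow> \<xi> < res s \<xi> i" and below: "res s \<xi> e < \<xi>"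
    using pseudocenter_first_return[OF assms(1-3)] by blast
  define S where "S = (\<Sum>i\<le>e. (-1) ^ i * gap s \<xi> i) - (-1) ^ e"
  obtain a b where ab: "meet s \<xi> a b" "a \<ge> 1" "b \<ge> 1" "avoids s \<xi> (-1) a" "avoids s \<xi> 1 b"
    and diff_ab: "int b - int a = - (int s + 1) * S"
    using meet_of_first_return[OF s1 e(2,3,1) above below] unfolding S_def by blast
  obtain km kp where k: "matching_exponents s \<xi> km kp" "int kp - int km = int b - int a"
    using matching_exponents_from_meet[OF assms(1) ab] by blast
  have "V \<subseteq> matching_set s"
    using in_components_subset[OF assms(2)] by (auto simp: bifurcation_set_def)
  moreover have "connected V" using assms(2) by (rule in_components_connected)
  moreover have "\<xi> \<in> V" using assms(3) by (simp add: is_pseudocenter_def)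
  ultimately have "\<forall>\<gamma>\<in>V. matching_exponents s \<gamma> km kp"
    using matching_exponents_constant_on_connected[OF assms(1)] k(1) by blast
  then have "has_matching_index s V (- (int s + 1) * S)"
    using k(2) diff_ab unfolding has_matching_index_def by (intro exI[of _ km] exI[of _ kp]) simp
  moreover have "word_norm s w = - 2 * S"
    unfolding S_def by (rule gap_sum[OF assms(1,4) e(2,1) above e(4)])
  then have "real_of_int (- (int s + 1) * S) = (real s + 1) / 2 * real_of_int (word_norm s w)"
    by (simp add: algebra_simps)
  moreover have "(int s + 1) dvd - (int s + 1) * S"
    by (simp only: minus_mult_left[symmetric] dvd_minus_iff dvd_triv_left)
  ultimately show ?thesis by blast
qed

end
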